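(* Let $M$ and $N$ be two unital JB$^*$-algebras, and let $\Delta:M^{++}\to N^{++}$ be a surjective isometry with respect to the distances induced by the JB$^*$-norms. Then there exists a Jordan $^*$-isomorphism $J:M\to N$ whose restriction to $M^{++}$ is $\Delta$.
   Context: A JB$^*$-algebra is a complex Jordan--Banach algebra $M$ (complex vector space with commutative bilinear product $\circ$ satisfying $(a\circ b)\circ a^2=a\circ(b\circ a^2)$ and a complete norm with $\|a\circ b\|\le\|a\|\|b\|$) together with a conjugate-linear algebra involution $*$ such that $\|U_a(a^* )\|=\|a\|^3$ for all $a$, where $U_a(x)=2(a\circ x)\circ a-a^2\circ x$. A Jordan $^*$-isomorphism is a complex-linear bijection preserving Jordan products and involutions. An element $a$ of a unital JB$^*$-algebra $M$ is invertible if there is $b\in M$ with $a\circ b=\mathbf{1}_M$ and $a^2\circ b=a$; its spectrum is the set of $\lambda\in\mathbb{C}$ with $a-\lambda\mathbf{1}_M$ not invertible; $a$ is positive if $a^*=a$ and its spectrum is contained in $[0,\infty)$. $M^{++}$ is the set of all positive invertible elements of $M$. *)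

theory Defs
  imports Complex_Main
begin

section \<open>Complex Banach spaces\<close>

text \<open>
  The distribution only provides real Banach spaces (class banach); a complex Banach space is a
  real one whose scalar multiplication extends to the complex numbers, with the same norm.
\<close>

class complex_banach = banach +
  fixes scaleC :: "complex \<Rightarrow> 'a \<Rightarrow> 'a"  (infixr "*\<^sub>C" 75)
  assumes scaleC_of_real: "complex_of_real r *\<^sub>C x = r *\<^sub>R x"
    and scaleC_add_right: "z *\<^sub>C (x + y) = z *\<^sub>C x + z *\<^sub>C y"
    and scaleC_add_left: "(z + w) *\<^sub>C x = z *\<^sub>C x + w *\<^sub>C x"
    and scaleC_scaleC: "z *\<^sub>C w *\<^sub>C x = (z * w) *\<^sub>C x"
    and norm_scaleC: "norm (z *\<^sub>C x) = cmod z * norm x"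


section \<open>\<open>JB\<^sup>*\<close>-algebras\<close>

text \<open>Right linearity of the product follows from commutativity.\<close>

class jordan_banach_algebra = complex_banach +
  fixes jprod :: "'a \<Rightarrow> 'a \<Rightarrow> 'a"  (infixl "\<circ>\<^sub>J" 70)
  assumes jprod_commute: "a \<circ>\<^sub>J b = b \<circ>\<^sub>J a"
    and jprod_add_left: "(a + b) \<circ>\<^sub>J c = a \<circ>\<^sub>J c + b \<circ>\<^sub>J c"
    and jprod_scaleC_left: "(z *\<^sub>C a) \<circ>\<^sub>J b = z *\<^sub>C (a \<circ>\<^sub>J b)"
    and jordan_identity: "(a \<circ>\<^sub>J b) \<circ>\<^sub>J (a \<circ>\<^sub>J a) = a \<circ>\<^sub>J (b \<circ>\<^sub>J (a \<circ>\<^sub>J a))"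
    and norm_jprod_le: "norm (a \<circ>\<^sub>J b) \<le> norm a * norm b"
begin

definition U_op :: "'a \<Rightarrow> 'a \<Rightarrow> 'a" where
  "U_op a x = 2 *\<^sub>C ((a \<circ>\<^sub>J x) \<circ>\<^sub>J a) - (a \<circ>\<^sub>J a) \<circ>\<^sub>J x"

end

class jb_star_algebra = jordan_banach_algebra +
  fixes star :: "'a \<Rightarrow> 'a"
  assumes star_star: "star (star a) = a"
    and star_add: "star (a + b) = star a + star b"
    and star_scaleC: "star (z *\<^sub>C a) = cnj z *\<^sub>C star a"
    and star_jprod: "star (a \<circ>\<^sub>J b) = star a \<circ>\<^sub>J star b"
    and norm_U_op_star: "norm (U_op a (star a)) = norm a ^ 3"

text \<open>The zero algebra, in which \<open>1 = 0\<close>, is not excluded.\<close>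

class unital_jb_star_algebra = jb_star_algebra + one +
  assumes one_jprod: "1 \<circ>\<^sub>J a = a"
begin

definition jordan_invertible :: "'a \<Rightarrow> bool" where
  "jordan_invertible a \<longleftrightarrow> (\<exists>b. a \<circ>\<^sub>J b = 1 \<and> (a \<circ>\<^sub>J a) \<circ>\<^sub>J b = a)"

definition jordan_spectrum :: "'a \<Rightarrow> complex set" where
  "jordan_spectrum a = {z. \<not> jordan_invertible (a - z *\<^sub>C 1)}"

definition jordan_positive :: "'a \<Rightarrow> bool" where
  "jordan_positive a \<longleftrightarrow> star a = a \<and> jordan_spectrum a \<subseteq> complex_of_real ` {0..}"

definition positive_invertibles :: "'a set" where
  "positive_invertibles = {a. jordan_positive a \<and> jordan_invertible a}"

end

definition jordan_star_isomorphism ::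
    "('a::jb_star_algebra \<Rightarrow> 'b::jb_star_algebra) \<Rightarrow> bool" where
  "jordan_star_isomorphism J \<longleftrightarrow>
     bij J \<and>
     (\<forall>a b. J (a + b) = J a + J b) \<and>
     (\<forall>z a. J (z *\<^sub>C a) = z *\<^sub>C J a) \<and>
     (\<forall>a b. J (a \<circ>\<^sub>J b) = J a \<circ>\<^sub>J J b) \<and>
     (\<forall>a. J (star a) = star (J a))"

end

theory Submission
  imports Defs "HOL-Analysis.Elementary_Normed_Spaces"
begin

text \<open>
  On the self-adjoint part, the positive invertible elements are the interior of the cone of squares,
  and the norm is the order unit norm of this cone. The argument of Mazur and Ulam, applied to small
  balls inside the cone, shows that \<open>\<Delta>\<close> preserves midpoints; hence it extends to a linear isometry
  \<open>T\<close> of the self-adjoint parts, which is an order isomorphism and maps 1 to 1.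

  The difference \<open>B\<close> of the Jordan product and the product pulled back along \<open>T\<close> is symmetric, and
  every \<open>B(a, _)\<close> generates isometries: if \<open>0 \<le> x \<le> 1\<close> then \<open>x\<^sup>2 \<le> x\<close>, so
  \<open>(x + e a)\<^sup>2 \<ge> 0\<close> gives \<open>x + 2 e (a \<circ> x) \<ge> - e\<^sup>2 a\<^sup>2\<close>, for both products and both signs of \<open>e\<close>.
  Therefore the flow of the quadratic field \<open>B(u, u) - B(h, h)\<close>, which vanishes at \<open>h\<close> and \<open>-h\<close>, is
  isometric, and the reflection argument of Mazur and Ulam forces it to vanish at 0 as well. So
  \<open>B = 0\<close>, that is, \<open>T\<close> preserves Jordan products, and the complexification of \<open>T\<close> is the required
  isomorphism.
\<close>

subsection \<open>Power associativity\<close>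

text \<open>No functional calculus enters: square roots and inverses come from convergent iterations
  in the closed real subalgebra generated by one element, where products associate, and the cone is
  described by the norm alone. The spectrum is met only when \<open>positive_invertibles\<close> is
  identified with the interior of the cone. The obstacle for the reflection argument is that the
  cone is not the whole space. The set of metric midpoints of two points has to lie in the cone on
  both sides, and its image has to fill the corresponding set; so short segments are treated before
  long ones, and the value at the vertex has to be recovered by a limit. Why \<open>B\<close> should
  vanish is seen in the Euclidean model: if every \<open>B a\<close> is skew, the form <B(a, b), c>
  is symmetric in a, b and skew in b, c, hence zero. Without an inner product, skewness is replaced
  by the estimate that the norm of \<open>b + t *\<^sub>R B a b\<close> exceeds that of
  \<open>b\<close> only to second order in \<open>t\<close>, and the permutation of arguments by a
  flow.\<close>

lemma scaleC_scaleR: "z *\<^sub>C (r *\<^sub>R x) = r *\<^sub>R (z *\<^sub>C (x::'a::complex_banach))"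
  by (metis scaleC_of_real scaleC_scaleC mult.commute)

lemma scaleC_zero_right [simp]: "z *\<^sub>C (0::'a::complex_banach) = 0"
  by (metis scaleC_add_right add_cancel_left_right)

lemma scaleC_minus_right: "z *\<^sub>C (- x) = - (z *\<^sub>C (x::'a::complex_banach))"
  by (metis scaleC_add_right scaleC_zero_right add.right_inverse minus_unique)

lemma scaleC_minus_left: "(- z) *\<^sub>C x = - (z *\<^sub>C (x::'a::complex_banach))"
  by (metis scaleC_scaleC scaleC_minus_right mult_minus1_right scaleC_of_real of_real_minus of_real_1
      scaleR_minus1_left)

lemma scaleC_diff_right: "z *\<^sub>C (x - y) = z *\<^sub>C x - z *\<^sub>C (y::'a::complex_banach)"
  by (metis scaleC_add_right scaleC_minus_right diff_conv_add_uminus)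

lemma scaleC_one [simp]: "1 *\<^sub>C x = (x::'a::complex_banach)"
  using scaleC_of_real[of 1 x] by simp

lemma scaleC_complex: "z *\<^sub>C x = Re z *\<^sub>R x + Im z *\<^sub>R (\<i> *\<^sub>C (x::'a::complex_banach))"
proof -
  have "z *\<^sub>C x = (complex_of_real (Re z) + complex_of_real (Im z) * \<i>) *\<^sub>C x"
    by (metis complex_eq mult.commute)
  then show ?thesis
    by (simp only: scaleC_add_left scaleC_of_real flip: scaleC_scaleC)
qed

lemma ii_scaleC_ii [simp]: "\<i> *\<^sub>C \<i> *\<^sub>C x = - (x::'a::complex_banach)"
  using scaleC_of_real[of "-1" x] by (simp add: scaleC_scaleC)

lemma jprod_add_right: "a \<circ>\<^sub>J (b + c) = a \<circ>\<^sub>J b + a \<circ>\<^sub>J (c::'a::jordan_banach_algebra)"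
  by (metis jprod_add_left jprod_commute)

lemma jprod_scaleC_right: "a \<circ>\<^sub>J (z *\<^sub>C b) = z *\<^sub>C (a \<circ>\<^sub>J (b::'a::jordan_banach_algebra))"
  by (metis jprod_scaleC_left jprod_commute)

interpretation jprod: bounded_bilinear "(\<circ>\<^sub>J) :: 'a::jordan_banach_algebra \<Rightarrow> 'a \<Rightarrow> 'a"
proof
  show "\<exists>K. \<forall>a b::'a. norm (a \<circ>\<^sub>J b) \<le> norm a * norm b * K"
    by (rule exI[of _ 1]) (simp add: norm_jprod_le)
qed (simp_all add: jprod_add_left jprod_add_right jprod_scaleC_left jprod_scaleC_right
       flip: scaleC_of_real)

lemmas jprod_simps =
  jprod.add_left jprod.add_right jprod.diff_left jprod.diff_right jprod.minus_left
  jprod.minus_right jprod.scaleR_left jprod.scaleR_right jprod_scaleC_left jprod_scaleC_right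

lemma jprod_one_right [simp]: "a \<circ>\<^sub>J 1 = (a::'a::unital_jb_star_algebra)"
  by (metis jprod_commute one_jprod)

declare one_jprod [simp]

text \<open>Polarization of \<open>jordan_identity\<close>, in which one element occurs three times:
  inserting sums and sorting by degree isolates the part linear in each of \<open>a\<close>,
  \<open>c\<close> and \<open>d\<close>.\<close>

lemma jordan_linearized:
  fixes a b c d :: "'a::jordan_banach_algebra"
  shows "(a \<circ>\<^sub>J b) \<circ>\<^sub>J (c \<circ>\<^sub>J d) + (c \<circ>\<^sub>J b) \<circ>\<^sub>J (a \<circ>\<^sub>J d) + (d \<circ>\<^sub>J b) \<circ>\<^sub>J (a \<circ>\<^sub>J c) =
         a \<circ>\<^sub>J (b \<circ>\<^sub>J (c \<circ>\<^sub>J d)) + c \<circ>\<^sub>J (b \<circ>\<^sub>J (a \<circ>\<^sub>J d)) + d \<circ>\<^sub>J (b \<circ>\<^sub>J (a \<circ>\<^sub>J c))"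
proof -
  define t where "t x y z = (x \<circ>\<^sub>J b) \<circ>\<^sub>J (y \<circ>\<^sub>J z) - x \<circ>\<^sub>J (b \<circ>\<^sub>J (y \<circ>\<^sub>J z))" for x y z
  have tl: "t (x + x') y z = t x y z + t x' y z" for x x' y z
    by (simp add: t_def jprod_simps)
  have tm: "t x (y + y') z = t x y z + t x y' z" for x y y' z
    by (simp add: t_def jprod_simps)
  have ts: "t x y z = t x z y" for x y z
    by (simp add: t_def jprod_commute[of y z])
  have tr: "t x y (z + z') = t x y z + t x y z'" for x y z z'
    by (metis ts tm)
  have t0: "t x x x = 0" for x
    by (simp add: t_def jordan_identity)
  have e2: "t x x y + t x x y + t y x x + (t x y y + t y x y + t y x y) = 0" for x y
  proof -
    have "t (x + y) (x + y) (x + y) = t x x x + t x x y + t x y x + t x y y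
        + t y x x + t y x y + t y y x + t y y y"
      unfolding tl tm tr by (simp add: add_ac)
    then show ?thesis
      unfolding t0 ts[of x y x] ts[of y y x] by (simp add: add_ac)
  qed
  have e3: "t x x y + t x x y + t y x x = 0" for x y
  proof -
    have m: "t x x (-y) = - t x x y" "t (-y) x x = - t y x x" "t x (-y) (-y) = t x y y"
      "t (-y) x (-y) = t y x y"
      by (simp_all add: t_def jprod_simps)
    \<comment> \<open>These are the parts of degree one and two in \<open>y\<close>. Replacing
      \<open>y\<close> by \<open>- y\<close> changes the sign of \<open>p\<close> only, so both
      vanish separately.\<close>
    define p q where "p = t x x y + t x x y + t y x x" and "q = t x y y + t y x y + t y x y"
    have "p + q = 0" using e2[of x y] by (simp only: p_def q_def)
    moreover have "- p + q = 0"
      using e2[of x "-y"] unfolding m by (simp add: p_def q_def)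
    ultimately have "(2::real) *\<^sub>R p = 0"
      by (metis add_cancel_right_left add.inverse_inverse add_eq_0_iff scaleR_2 add.right_inverse)
    then show ?thesis by (simp add: p_def)
  qed
  have "t (a + c) (a + c) d + t (a + c) (a + c) d + t d (a + c) (a + c)
      = (t a a d + t a a d + t d a a) + (t c c d + t c c d + t d c c)
        + (2::real) *\<^sub>R (t a c d + t c a d + t d a c)"
    unfolding tl tm tr scaleR_2 using ts[of d c a] by (simp add: add_ac)
  then have "(2::real) *\<^sub>R (t a c d + t c a d + t d a c) = 0"
    unfolding e3 by simp
  then have "t a c d + t c a d + t d a c = 0" by simp
  then show ?thesis by (simp add: t_def algebra_simps)
qed

primrec jpow :: "'a::unital_jb_star_algebra \<Rightarrow> nat \<Rightarrow> 'a" where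
  "jpow y 0 = 1"
| "jpow y (Suc n) = y \<circ>\<^sub>J jpow y n"

text \<open>The linearized identity gives \<open>rec\<close>: multiplication by the power n + 2 is a
  polynomial in multiplications by \<open>y\<close>, its square and lower powers. The lemma is used
  in two rounds: for \<open>f\<close> the multiplication by \<open>y\<close> or its square, and then
  by an arbitrary power.\<close>

lemma jpow_commute_operator:
  fixes y :: "'a::unital_jb_star_algebra"
  assumes add: "\<And>x z. f (x + z) = f x + f z"
    and c1: "\<And>x. f (y \<circ>\<^sub>J x) = y \<circ>\<^sub>J f x"
    and c2: "\<And>x. f ((y \<circ>\<^sub>J y) \<circ>\<^sub>J x) = (y \<circ>\<^sub>J y) \<circ>\<^sub>J f x"
  shows "f (jpow y n \<circ>\<^sub>J x) = jpow y n \<circ>\<^sub>J f x"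
proof (induction n arbitrary: x rule: induct_nat_012)
  case 0
  show ?case by simp
next
  case 1
  show ?case by (simp add: c1)
next
  case (ge2 n)
  have f0: "f 0 = 0" using add[of 0 0] by simp
  have fm: "f (- z) = - f z" for z
    using add[of z "- z"] f0 by (simp add: eq_neg_iff_add_eq_0 add.commute)
  have fd: "f (u - v) = f u - f v" for u v
    using add[of u "- v"] fm by simp
  have rec: "jpow y (Suc (Suc n)) \<circ>\<^sub>J z = (y \<circ>\<^sub>J y) \<circ>\<^sub>J (jpow y n \<circ>\<^sub>J z)
      + jpow y (Suc n) \<circ>\<^sub>J (y \<circ>\<^sub>J z) + jpow y (Suc n) \<circ>\<^sub>J (y \<circ>\<^sub>J z)
      - y \<circ>\<^sub>J (y \<circ>\<^sub>J (jpow y n \<circ>\<^sub>J z)) - jpow y n \<circ>\<^sub>J (y \<circ>\<^sub>J (y \<circ>\<^sub>J z))" for z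
    using jordan_linearized[of y y "jpow y n" z]
    by (simp add: jprod_commute[of "jpow y n" y] jprod_commute[of z] jprod_commute[of "y \<circ>\<^sub>J z"]
        algebra_simps)
  show ?case
    unfolding rec by (simp only: add fd c1 c2 ge2)
qed

lemma jpow_operators_commute:
  fixes y :: "'a::unital_jb_star_algebra"
  shows "jpow y m \<circ>\<^sub>J (jpow y n \<circ>\<^sub>J x) = jpow y n \<circ>\<^sub>J (jpow y m \<circ>\<^sub>J x)"
proof -
  have y12: "y \<circ>\<^sub>J ((y \<circ>\<^sub>J y) \<circ>\<^sub>J z) = (y \<circ>\<^sub>J y) \<circ>\<^sub>J (y \<circ>\<^sub>J z)" for z
    using jordan_identity[of y z] by (metis jprod_commute)
  have 1: "y \<circ>\<^sub>J (jpow y n \<circ>\<^sub>J z) = jpow y n \<circ>\<^sub>J (y \<circ>\<^sub>J z)" for n z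
    by (rule jpow_commute_operator) (simp_all add: jprod_simps y12)
  have 2: "(y \<circ>\<^sub>J y) \<circ>\<^sub>J (jpow y n \<circ>\<^sub>J z) = jpow y n \<circ>\<^sub>J ((y \<circ>\<^sub>J y) \<circ>\<^sub>J z)" for n z
    by (rule jpow_commute_operator) (simp_all add: jprod_simps y12)
  show ?thesis
    by (rule jpow_commute_operator) (simp_all add: jprod_simps 1 2)
qed

lemma jpow_add: "jpow y m \<circ>\<^sub>J jpow y n = jpow (y::'a::unital_jb_star_algebra) (m + n)"
proof (induction n)
  case (Suc n)
  then show ?case
    using jpow_operators_commute[of y m 1 "jpow y n"] by simp
qed simp

subsection \<open>The closed subalgebra generated by an element\<close>

text \<open>The span is over the reals, so that for self-adjoint \<open>y\<close> every element is
  self-adjoint; complex combinations are written out where they occur.\<close>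

definition jalg :: "'a::unital_jb_star_algebra \<Rightarrow> 'a set" where
  "jalg y = closure (span (range (jpow y)))"

lemma closed_jalg [simp]: "closed (jalg y)"
  by (simp add: jalg_def)

lemma subspace_jalg: "subspace (jalg y)"
proof -
  let ?S = "span (range (jpow y))"
  have "u + v \<in> closure ?S" if uv: "u \<in> closure ?S" "v \<in> closure ?S" for u v
  proof -
    obtain f g where "\<forall>n. f n \<in> ?S" "f \<longlonglongrightarrow> u" "\<forall>n. g n \<in> ?S" "g \<longlonglongrightarrow> v"
      using uv unfolding closure_sequential by blast
    then show ?thesis
      unfolding closure_sequential
      by (intro exI[of _ "\<lambda>n. f n + g n"]) (auto intro: span_add tendsto_add)
  qed
  moreover have "c *\<^sub>R u \<in> closure ?S" if u: "u \<in> closure ?S" for u c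
  proof -
    obtain f where "\<forall>n. f n \<in> ?S" "f \<longlonglongrightarrow> u"
      using u unfolding closure_sequential by blast
    then show ?thesis
      unfolding closure_sequential
      by (intro exI[of _ "\<lambda>n. c *\<^sub>R f n"]) (auto intro: span_scale tendsto_scaleR)
  qed
  moreover have "0 \<in> closure ?S"
    by (meson closure_subset span_zero subsetD)
  ultimately show ?thesis
    by (auto simp: jalg_def subspace_def)
qed

lemma jpow_in_jalg: "jpow y n \<in> jalg y"
  unfolding jalg_def by (meson closure_subset rangeI span_base subsetD)

lemma one_in_jalg [simp]: "1 \<in> jalg y"
  using jpow_in_jalg[of y 0] by simp

lemma self_in_jalg [simp]: "y \<in> jalg y"
  using jpow_in_jalg[of y 1] by simp

lemma jalg_minimal:
  assumes "closed S" "subspace S" "\<And>n. jpow y n \<in> S"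
  shows "jalg y \<subseteq> S"
  unfolding jalg_def using assms by (metis closure_minimal image_subsetI span_minimal)

lemma jalg_add [simp]: "a \<in> jalg y \<Longrightarrow> b \<in> jalg y \<Longrightarrow> a + b \<in> jalg y"
  and jalg_diff [simp]: "a \<in> jalg y \<Longrightarrow> b \<in> jalg y \<Longrightarrow> a - b \<in> jalg y"
  and jalg_scaleR [simp]: "a \<in> jalg y \<Longrightarrow> r *\<^sub>R a \<in> jalg y"
  using subspace_jalg[of y] by (auto simp: subspace_add subspace_diff subspace_scale)

text \<open>A product has two factors, so minimality is applied twice: once with the fixed factor a
  power of \<open>y\<close>, and then with a fixed arbitrary factor.\<close>

lemma jalg_jprod [simp]:
  assumes "a \<in> jalg y" "b \<in> jalg y"
  shows "a \<circ>\<^sub>J b \<in> jalg y"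
proof -
  have cl: "closed {z. z \<circ>\<^sub>J c \<in> jalg y}" for c
  proof -
    have "{z. z \<circ>\<^sub>J c \<in> jalg y} = (\<lambda>z. z \<circ>\<^sub>J c) -` jalg y" by auto
    moreover have "continuous_on UNIV (\<lambda>z. z \<circ>\<^sub>J c)"
      by (intro jprod.continuous_on continuous_intros)
    ultimately show ?thesis by (metis closed_jalg closed_vimage)
  qed
  have sub: "subspace {z. z \<circ>\<^sub>J c \<in> jalg y}" for c
    using subspace_jalg[of y]
    by (auto simp: subspace_def jprod_simps jprod.zero_left)
  have 1: "jalg y \<subseteq> {z. z \<circ>\<^sub>J jpow y n \<in> jalg y}" for n
    by (rule jalg_minimal[OF cl sub]) (simp add: jpow_add jpow_in_jalg)
  have "jalg y \<subseteq> {z. z \<circ>\<^sub>J a \<in> jalg y}"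
    by (rule jalg_minimal[OF cl sub]) (use 1 assms in \<open>auto simp: jprod_commute[of _ a]\<close>)
  then show ?thesis using assms by (auto simp: jprod_commute[of a])
qed

lemma jalg_jpow [simp]: "a \<in> jalg y \<Longrightarrow> jpow a n \<in> jalg y"
  by (induction n) auto

lemma jalg_operators_commute:
  assumes "a \<in> jalg y" "b \<in> jalg y"
  shows "a \<circ>\<^sub>J (b \<circ>\<^sub>J x) = b \<circ>\<^sub>J (a \<circ>\<^sub>J x)"
proof -
  have cl: "closed {z. \<forall>x. z \<circ>\<^sub>J (c \<circ>\<^sub>J x) = c \<circ>\<^sub>J (z \<circ>\<^sub>J x)}" for c :: 'a
    by (intro closed_Collect_all closed_Collect_eq jprod.continuous_on continuous_intros)
  have sub: "subspace {z. \<forall>x. z \<circ>\<^sub>J (c \<circ>\<^sub>J x) = c \<circ>\<^sub>J (z \<circ>\<^sub>J x)}" for c :: 'a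
    by (auto simp: subspace_def jprod_simps jprod.zero_left jprod.zero_right)
  have 1: "jalg y \<subseteq> {z. \<forall>x. z \<circ>\<^sub>J (jpow y n \<circ>\<^sub>J x) = jpow y n \<circ>\<^sub>J (z \<circ>\<^sub>J x)}" for n
    by (rule jalg_minimal[OF cl sub]) (simp add: jpow_operators_commute)
  have "jalg y \<subseteq> {z. \<forall>x. z \<circ>\<^sub>J (a \<circ>\<^sub>J x) = a \<circ>\<^sub>J (z \<circ>\<^sub>J x)}"
    by (rule jalg_minimal[OF cl sub]) (use subsetD[OF 1 assms(1)] in \<open>simp add: eq_commute\<close>)
  then show ?thesis using assms by auto
qed

lemma jalg_assoc:
  assumes "a \<in> jalg y" "b \<in> jalg y"
  shows "(a \<circ>\<^sub>J x) \<circ>\<^sub>J b = a \<circ>\<^sub>J (x \<circ>\<^sub>J b)"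
  using jalg_operators_commute[OF assms, of x] by (metis jprod_commute)

subsection \<open>The involution\<close>

lemma star_zero [simp]: "star 0 = (0::'a::jb_star_algebra)"
  by (metis star_add add_cancel_left_right)

lemma star_scaleR: "star (r *\<^sub>R x) = r *\<^sub>R star (x::'a::jb_star_algebra)"
  by (metis star_scaleC scaleC_of_real complex_cnj_complex_of_real)

lemma star_minus: "star (- x) = - star (x::'a::jb_star_algebra)"
  using star_scaleR[of "-1" x] by simp

lemma star_diff: "star (x - y) = star x - star (y::'a::jb_star_algebra)"
  by (metis star_add star_minus diff_conv_add_uminus)

lemma star_one [simp]: "star 1 = (1::'a::unital_jb_star_algebra)"
  using star_jprod[of "star 1" "1::'a"] by (simp add: star_star)

text \<open>Continuity of the involution has to be extracted from the cubic norm axiom: estimating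
  the two terms of \<open>U_op\<close> by 2 + 1 = 3 products and cancelling the square of
  \<open>norm z\<close> suffices.\<close>

lemma norm_le_star: "norm z \<le> 3 * norm (star (z::'a::jb_star_algebra))"
proof -
  have "norm z ^ 3 = norm (2 *\<^sub>C ((z \<circ>\<^sub>J star z) \<circ>\<^sub>J z) - (z \<circ>\<^sub>J z) \<circ>\<^sub>J star z)"
    by (simp only: U_op_def flip: norm_U_op_star)
  also have "\<dots> \<le> 2 * norm ((z \<circ>\<^sub>J star z) \<circ>\<^sub>J z) + norm ((z \<circ>\<^sub>J z) \<circ>\<^sub>J star z)"
    using norm_triangle_ineq4[of "2 *\<^sub>C ((z \<circ>\<^sub>J star z) \<circ>\<^sub>J z)" "(z \<circ>\<^sub>J z) \<circ>\<^sub>J star z"]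
    by (simp add: norm_scaleC)
  also have "\<dots> \<le> 2 * (norm z * norm (star z) * norm z) + norm z * norm z * norm (star z)"
    by (intro add_mono mult_left_mono order_trans[OF norm_jprod_le] mult_right_mono norm_jprod_le) auto
  finally have *: "norm z ^ 3 \<le> 3 * norm (star z) * norm z ^ 2"
    by (simp add: power2_eq_square algebra_simps)
  show ?thesis
  proof (cases "z = 0")
    case False
    then have "norm z ^ 2 > 0" by simp
    moreover have "norm z * norm z ^ 2 \<le> 3 * norm (star z) * norm z ^ 2"
      using * by (simp add: power3_eq_cube power2_eq_square)
    ultimately show ?thesis by (meson mult_le_cancel_right_pos)
  qed simp
qed

lemma bounded_linear_star: "bounded_linear (star :: 'a::jb_star_algebra \<Rightarrow> 'a)"
proof
  show "\<exists>K. \<forall>x::'a. norm (star x) \<le> norm x * K"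
    by (intro exI[of _ 3] allI, subst mult.commute) (metis norm_le_star star_star)
qed (simp_all add: star_add star_scaleR)

definition self_adjoint :: "'a::jb_star_algebra set" where
  "self_adjoint = {a. star a = a}"

lemma closed_self_adjoint: "closed (self_adjoint :: 'a::jb_star_algebra set)"
  unfolding self_adjoint_def
  by (intro closed_Collect_eq bounded_linear.continuous_on[OF bounded_linear_star] continuous_intros)

lemma subspace_self_adjoint: "subspace (self_adjoint :: 'a::jb_star_algebra set)"
  by (auto simp: self_adjoint_def subspace_def star_add star_scaleR)

lemma self_adjoint_zero [simp]: "0 \<in> self_adjoint"
  by (simp add: self_adjoint_def)

lemma self_adjoint_one [simp]: "(1::'a::unital_jb_star_algebra) \<in> self_adjoint"
  by (simp add: self_adjoint_def)

lemma self_adjoint_jprod [simp]: "a \<in> self_adjoint \<Longrightarrow> b \<in> self_adjoint \<Longrightarrow> a \<circ>\<^sub>J b \<in> self_adjoint"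
  by (simp add: self_adjoint_def star_jprod)

lemma self_adjoint_add [simp]: "a \<in> self_adjoint \<Longrightarrow> b \<in> self_adjoint \<Longrightarrow> a + b \<in> self_adjoint"
  and self_adjoint_diff [simp]: "a \<in> self_adjoint \<Longrightarrow> b \<in> self_adjoint \<Longrightarrow> a - b \<in> self_adjoint"
  and self_adjoint_minus [simp]: "a \<in> self_adjoint \<Longrightarrow> - a \<in> self_adjoint"
  and self_adjoint_scaleR [simp]: "a \<in> self_adjoint \<Longrightarrow> r *\<^sub>R a \<in> self_adjoint"
  by (simp_all add: self_adjoint_def star_add star_diff star_minus star_scaleR)

lemma jalg_self_adjoint:
  assumes "y \<in> self_adjoint" "a \<in> jalg y"
  shows "a \<in> self_adjoint"
proof -
  have "jpow y n \<in> self_adjoint" for n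
    using assms(1) by (induction n) auto
  then show ?thesis
    using jalg_minimal[OF closed_self_adjoint subspace_self_adjoint] assms(2) by blast
qed

text \<open>The cubic axiom at 1 leaves the values 0 and 1 for the norm; the value 0 is that of the
  zero algebra, hence the inequality.\<close>

lemma norm_one_le: "norm (1::'a::unital_jb_star_algebra) \<le> 1"
proof -
  have "(2::complex) *\<^sub>C (1::'a) - 1 = 1"
    using scaleC_of_real[of 2 "1::'a"] by (simp add: scaleR_2)
  then have "norm (1::'a) = norm (1::'a) ^ 3"
    using norm_U_op_star[of "1::'a"] by (simp add: U_op_def)
  then have "norm (1::'a) * (norm (1::'a) - 1) * (norm (1::'a) + 1) = 0"
    by (simp add: power3_eq_cube algebra_simps)
  moreover have "norm (1::'a) + 1 \<noteq> 0"
    using norm_ge_zero[of "1::'a"] by linarith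
  ultimately show ?thesis by auto
qed

subsection \<open>The C*-identity on the subalgebra generated by a self-adjoint element\<close>

text \<open>For z = a + i b or z = a - i b the product of \<open>z\<close> and \<open>star z\<close>
  is the sum of squares \<open>s\<close>, and by associativity \<open>U_op z (star z)\<close> is
  \<open>s \<circ>\<^sub>J z\<close>. The cubic axiom then bounds the square of
  \<open>norm z\<close> by \<open>norm s\<close>, and \<open>a\<close> is the mean of the two
  choices of z.\<close>

lemma norm_power2_le_sum_squares:
  fixes y :: "'a::unital_jb_star_algebra"
  assumes y: "y \<in> self_adjoint" and a: "a \<in> jalg y" and b: "b \<in> jalg y"
  shows "norm a ^ 2 \<le> norm (a \<circ>\<^sub>J a + b \<circ>\<^sub>J b)"
proof -
  have sa: "star a = a" "star b = b"
    using jalg_self_adjoint[OF y a] jalg_self_adjoint[OF y b] by (auto simp: self_adjoint_def)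
  define s where "s = a \<circ>\<^sub>J a + b \<circ>\<^sub>J b"
  have ab: "(a \<circ>\<^sub>J a) \<circ>\<^sub>J b = a \<circ>\<^sub>J (a \<circ>\<^sub>J b)" "(b \<circ>\<^sub>J b) \<circ>\<^sub>J a = b \<circ>\<^sub>J (a \<circ>\<^sub>J b)"
    "b \<circ>\<^sub>J (a \<circ>\<^sub>J a) = a \<circ>\<^sub>J (a \<circ>\<^sub>J b)" "a \<circ>\<^sub>J (b \<circ>\<^sub>J b) = b \<circ>\<^sub>J (a \<circ>\<^sub>J b)"
    "b \<circ>\<^sub>J a = a \<circ>\<^sub>J b" "(a \<circ>\<^sub>J b) \<circ>\<^sub>J a = a \<circ>\<^sub>J (a \<circ>\<^sub>J b)" "(a \<circ>\<^sub>J b) \<circ>\<^sub>J b = b \<circ>\<^sub>J (a \<circ>\<^sub>J b)"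
    using jalg_assoc[OF a b, of a] jalg_assoc[OF b a, of b]
    by (simp_all add: jprod_commute)
  have cube: "norm z ^ 3 \<le> norm s * norm z"
    if z: "z = a + \<i> *\<^sub>C b \<or> z = a - \<i> *\<^sub>C b" for z
  proof -
    have zz: "z \<circ>\<^sub>J star z = s"
      using z by (auto simp: star_add star_diff star_scaleC sa jprod_simps s_def ab
          scaleC_minus_right scaleC_minus_left scaleC_diff_right scaleC_add_right)
    have "(z \<circ>\<^sub>J z) \<circ>\<^sub>J star z = s \<circ>\<^sub>J z"
      using z by (auto simp: star_add star_diff star_scaleC sa jprod_simps s_def ab
          scaleC_minus_right scaleC_minus_left scaleC_diff_right scaleC_add_right)
    then have "U_op z (star z) = s \<circ>\<^sub>J z"
      using scaleC_of_real[of 2 "s \<circ>\<^sub>J z"] by (simp add: U_op_def zz scaleR_2)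
    then show ?thesis
      by (metis norm_U_op_star norm_jprod_le)
  qed
  have bd: "norm z ^ 2 \<le> norm s" if z: "z = a + \<i> *\<^sub>C b \<or> z = a - \<i> *\<^sub>C b" for z
  proof (cases "z = 0")
    case False
    then show ?thesis
      using cube[OF z] by (simp add: power3_eq_cube power2_eq_square)
  qed simp
  have "2 *\<^sub>R a = (a + \<i> *\<^sub>C b) + (a - \<i> *\<^sub>C b)"
    by (simp add: scaleR_2)
  then have "2 * norm a \<le> norm (a + \<i> *\<^sub>C b) + norm (a - \<i> *\<^sub>C b)"
    by (metis norm_scaleR norm_triangle_ineq abs_numeral)
  moreover have "norm (a + \<i> *\<^sub>C b) \<le> sqrt (norm s)" "norm (a - \<i> *\<^sub>C b) \<le> sqrt (norm s)"
    using bd by (auto intro: real_le_rsqrt)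
  ultimately have "norm a \<le> sqrt (norm s)" by linarith
  then have "norm a ^ 2 \<le> sqrt (norm s) ^ 2"
    by (intro power_mono) auto
  then show ?thesis by (simp add: s_def)
qed

lemma norm_jprod_self:
  fixes y :: "'a::unital_jb_star_algebra"
  assumes y: "y \<in> self_adjoint"
  shows "norm (y \<circ>\<^sub>J y) = norm y ^ 2"
proof -
  have "norm y ^ 2 \<le> norm (y \<circ>\<^sub>J y + 0 \<circ>\<^sub>J 0)"
    by (rule norm_power2_le_sum_squares[OF y])
      (use subspace_jalg[of y] in \<open>auto simp: subspace_0\<close>)
  then show ?thesis
    using norm_jprod_le[of y y] by (simp add: power2_eq_square jprod.zero_left)
qed

text \<open>The square root is \<open>1 - u\<close> with \<open>u = (t + u\<^sup>2) / 2\<close> for \<open>t = 1 - x\<close>. The increments of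
  the iteration are dominated by those of the same iteration for the real number \<open>t = 1\<close>, which
  converges; this also covers the boundary case \<open>norm t = 1\<close>.\<close>

lemma ex_square_root:
  fixes x :: "'a::unital_jb_star_algebra"
  assumes x: "x \<in> jalg y" and le: "norm (1 - x) \<le> 1"
  obtains w where "w \<in> jalg y" "w \<circ>\<^sub>J w = x"
proof -
  define t where "t = 1 - x"
  define u where "u = rec_nat (0::'a) (\<lambda>_ v. (1/2) *\<^sub>R (t + v \<circ>\<^sub>J v))"
  define r where "r = rec_nat (0::real) (\<lambda>_ v. (1/2) * (1 + v * v))"
  have u0: "u 0 = 0" and uS: "u (Suc n) = (1/2) *\<^sub>R (t + u n \<circ>\<^sub>J u n)" for n
    by (simp_all add: u_def)
  have r0: "r 0 = 0" and rS: "r (Suc n) = (1/2) * (1 + r n * r n)" for n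
    by (simp_all add: r_def)
  have rb: "0 \<le> r n \<and> r n \<le> 1" for n
  proof (induction n)
    case (Suc n)
    then have "r n * r n \<le> 1" by (simp add: mult_le_one)
    then show ?case by (simp add: rS)
  qed (simp add: r0)
  have rmono: "r n \<le> r (Suc n)" for n
    using zero_le_square[of "1 - r n"] unfolding rS by (simp add: algebra_simps)
  have un: "norm (u n) \<le> r n" for n
  proof (induction n)
    case (Suc n)
    have "norm (t + u n \<circ>\<^sub>J u n) \<le> 1 + r n * r n"
      using norm_triangle_ineq[of t "u n \<circ>\<^sub>J u n"] norm_jprod_le[of "u n" "u n"] le
        mult_mono'[OF Suc Suc] by (simp add: t_def)
    then show ?case by (simp add: uS rS)
  qed (simp add: u0 r0)
  have inc: "norm (u (Suc n) - u n) \<le> r (Suc n) - r n" for n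
  proof (induction n)
    case 0
    show ?case using le by (simp add: uS rS u0 r0 t_def jprod.zero_left)
  next
    case (Suc n)
    have eq: "u (Suc (Suc n)) - u (Suc n) = (1/2) *\<^sub>R ((u (Suc n) - u n) \<circ>\<^sub>J (u (Suc n) + u n))"
      unfolding uS[of "Suc n"] uS[of n, THEN arg_cong, of "\<lambda>v. _ - v"]
      by (simp add: jprod_simps jprod_commute[of "u n" "u (Suc n)"] algebra_simps)
    have "norm ((u (Suc n) - u n) \<circ>\<^sub>J (u (Suc n) + u n)) \<le>
        (r (Suc n) - r n) * (r (Suc n) + r n)"
      by (intro order_trans[OF norm_jprod_le] mult_mono' Suc
          order_trans[OF norm_triangle_ineq] add_mono un) auto
    then show ?case
      unfolding eq using rS[of "Suc n"] rS[of n] by (simp add: algebra_simps)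
  qed
  have "incseq r" by (rule incseq_SucI) (rule rmono)
  then have "convergent r"
    by (metis Bseq_monoseq_convergent BseqI' rb abs_of_nonneg incseq_imp_monoseq real_norm_def)
  then have rc: "Cauchy r" by (simp add: Cauchy_convergent_iff)
  have diff: "norm (u m - u n) \<le> r m - r n" if "n \<le> m" for m n
    using that
  proof (induction m rule: dec_induct)
    case (step k)
    show ?case
      using norm_triangle_ineq[of "u (Suc k) - u k" "u k - u n"] inc[of k] step.IH by simp
  qed simp
  have "Cauchy u"
  proof (rule metric_CauchyI)
    fix e :: real assume "e > 0"
    then obtain M where M: "\<And>m n. m \<ge> M \<Longrightarrow> n \<ge> M \<Longrightarrow> dist (r m) (r n) < e"
      using rc by (meson metric_CauchyD)
    have "dist (u m) (u n) < e" if "m \<ge> M" "n \<ge> M" for m n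
    proof (cases "n \<le> m")
      case True
      then show ?thesis using diff[OF True] M[OF that] by (simp add: dist_norm)
    next
      case False
      then have "m \<le> n" by simp
      then show ?thesis
        using diff[of m n] M[OF that] by (simp add: dist_norm norm_minus_commute abs_minus_commute)
    qed
    then show "\<exists>M. \<forall>m\<ge>M. \<forall>n\<ge>M. dist (u m) (u n) < e" by blast
  qed
  then obtain l where l: "u \<longlonglongrightarrow> l" using Cauchy_convergent convergentD by blast
  have "u n \<in> jalg y" for n
  proof (induction n)
    case 0
    show ?case using subspace_jalg[of y] by (simp add: u0 subspace_0)
  next
    case (Suc n)
    then show ?case using x by (simp add: uS t_def)
  qed
  then have lj: "l \<in> jalg y" using closed_jalg l by (meson closed_sequentially)
  have "(\<lambda>n. u (Suc n)) \<longlonglongrightarrow> (1/2) *\<^sub>R (t + l \<circ>\<^sub>J l)"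
    unfolding uS by (intro tendsto_intros jprod.tendsto l)
  then have "l = (1/2) *\<^sub>R (t + l \<circ>\<^sub>J l)"
    using LIMSEQ_Suc[OF l] LIMSEQ_unique by blast
  then have "2 *\<^sub>R l = t + l \<circ>\<^sub>J l"
    by (metis scaleR_scaleR scaleR_one mult.commute divide_self_if times_divide_eq_right mult_1_right zero_neq_numeral)
  then have "(1 - l) \<circ>\<^sub>J (1 - l) = x"
    by (simp add: jprod_simps t_def scaleR_2 algebra_simps)
  then show ?thesis using lj that[of "1 - l"] by simp
qed

subsection \<open>The order on the self-adjoint part\<close>

text \<open>The ball of radius g about g * 1 stands for the spectral condition that the spectrum
  lies in [0, 2 g]. In this form sums and multiples need only the triangle inequality.\<close>

definition positive_cone :: "'a::unital_jb_star_algebra set" where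
  "positive_cone = {x \<in> self_adjoint. \<exists>g\<ge>0. norm (g *\<^sub>R 1 - x) \<le> g}"

lemma positive_cone_self_adjoint: "x \<in> positive_cone \<Longrightarrow> x \<in> self_adjoint"
  by (simp add: positive_cone_def)

lemma positive_cone_add [simp]:
  assumes "x \<in> positive_cone" "y \<in> positive_cone"
  shows "x + y \<in> positive_cone"
proof -
  obtain g h where g: "g \<ge> 0" "norm (g *\<^sub>R 1 - x) \<le> g" and h: "h \<ge> 0" "norm (h *\<^sub>R 1 - y) \<le> h"
    using assms by (auto simp: positive_cone_def)
  have "norm ((g + h) *\<^sub>R 1 - (x + y)) \<le> g + h"
    using norm_triangle_ineq[of "g *\<^sub>R 1 - x" "h *\<^sub>R 1 - y"] g h by (simp add: algebra_simps)
  then show ?thesis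
    using assms g h by (auto simp: positive_cone_def intro!: exI[of _ "g + h"])
qed

lemma positive_cone_scaleR [simp]:
  assumes "x \<in> positive_cone" "r \<ge> 0"
  shows "r *\<^sub>R x \<in> positive_cone"
proof -
  obtain g where g: "g \<ge> 0" "norm (g *\<^sub>R 1 - x) \<le> g"
    using assms by (auto simp: positive_cone_def)
  have "norm ((r * g) *\<^sub>R 1 - r *\<^sub>R x) = r * norm (g *\<^sub>R 1 - x)"
    using assms(2) by (metis abs_of_nonneg norm_scaleR scaleR_diff_right scaleR_scaleR)
  then show ?thesis
    using assms g by (auto simp: positive_cone_def mult_left_mono intro!: exI[of _ "r * g"])
qed

lemma positive_cone_shift:
  assumes "h \<in> self_adjoint" "norm h \<le> g"
  shows "h + g *\<^sub>R 1 \<in> positive_cone"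
  using assms order_trans[OF norm_ge_zero assms(2)]
  by (auto simp: positive_cone_def intro!: exI[of _ g])

lemma positive_cone_shift': "h \<in> self_adjoint \<Longrightarrow> norm h \<le> g \<Longrightarrow> g *\<^sub>R 1 - h \<in> positive_cone"
  using positive_cone_shift[of "- h" g] by simp

lemma positive_cone_one [simp]: "r \<ge> 0 \<Longrightarrow> r *\<^sub>R 1 \<in> positive_cone"
  using positive_cone_shift[of 0 r] by simp

lemma positive_cone_one' [simp]: "1 \<in> positive_cone"
  using positive_cone_one[of 1] by simp

lemma positive_cone_zero [simp]: "0 \<in> positive_cone"
  using positive_cone_one[of 0] by simp

lemma positive_cone_sum:
  "(\<And>i. i \<in> I \<Longrightarrow> f i \<in> positive_cone) \<Longrightarrow> sum f I \<in> positive_cone"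
  by (induction I rule: infinite_finite_induct) auto

lemma positive_cone_ex_square_root:
  assumes x: "x \<in> positive_cone" and y: "x \<in> jalg y"
  obtains w where "w \<in> jalg y" "w \<circ>\<^sub>J w = x"
proof -
  obtain g where g: "g \<ge> 0" "norm (g *\<^sub>R 1 - x) \<le> g"
    using x by (auto simp: positive_cone_def)
  \<comment> \<open>Adding 1 preserves the bound and makes \<open>G\<close> nonzero, so that
    \<open>x\<close> can be rescaled.\<close>
  define G where "G = g + 1"
  have G: "G > 0" "G \<noteq> 0" using g by (auto simp: G_def)
  have "norm (G *\<^sub>R 1 - x) \<le> G"
    using norm_triangle_ineq[of "g *\<^sub>R 1 - x" 1] g norm_one_le[where 'a='a]
    by (simp add: G_def algebra_simps)
  moreover have "1 - (1 / G) *\<^sub>R x = (1 / G) *\<^sub>R (G *\<^sub>R 1 - x)"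
    using G by (simp add: scaleR_diff_right)
  ultimately have "norm (1 - (1 / G) *\<^sub>R x) \<le> 1"
    using G by simp
  then obtain w where w: "w \<in> jalg y" "w \<circ>\<^sub>J w = (1 / G) *\<^sub>R x"
    by (rule ex_square_root[OF jalg_scaleR[OF y]])
  then have "(sqrt G *\<^sub>R w) \<circ>\<^sub>J (sqrt G *\<^sub>R w) = x"
    using G by (simp add: jprod_simps)
  then show ?thesis by (rule that[OF jalg_scaleR[OF w(1)]])
qed

text \<open>If w is a square root of 1 - a^2, then w^2 + a^2 = 1, and the inequality for sums of
  squares gives norm at most 1 for w, hence for w^2.\<close>

lemma norm_one_minus_square_le:
  fixes a :: "'a::unital_jb_star_algebra"
  assumes a: "a \<in> self_adjoint" "norm a \<le> 1"
  shows "norm (1 - a \<circ>\<^sub>J a) \<le> 1"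
proof -
  have "norm (a \<circ>\<^sub>J a) \<le> 1"
    using norm_jprod_le[of a a] mult_le_one[OF a(2) norm_ge_zero a(2)] by linarith
  then have "norm (1 - (1 - a \<circ>\<^sub>J a)) \<le> 1" by simp
  then obtain w where w: "w \<in> jalg a" "w \<circ>\<^sub>J w = 1 - a \<circ>\<^sub>J a"
    by (rule ex_square_root[OF jalg_diff[OF one_in_jalg jalg_jprod[OF self_in_jalg self_in_jalg]]])
  have "norm w ^ 2 \<le> 1"
    using norm_power2_le_sum_squares[OF a(1) w(1), of a] norm_one_le[where 'a='a]
    by (simp add: w)
  then show ?thesis
    using norm_jprod_le[of w w] by (simp add: w power2_eq_square)
qed

lemma square_in_positive_cone [simp]:
  assumes "a \<in> self_adjoint"
  shows "a \<circ>\<^sub>J a \<in> positive_cone"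
proof -
  define r where "r = norm a + 1"
  have r: "r > 0" by (simp add: r_def add_nonneg_pos)
  define b where "b = (1 / r) *\<^sub>R a"
  have "norm b \<le> 1" using r by (simp add: b_def r_def)
  moreover have b: "b \<in> self_adjoint" using assms by (simp add: b_def)
  ultimately have "b \<circ>\<^sub>J b \<in> positive_cone"
    using norm_one_minus_square_le[of b] by (auto simp: positive_cone_def intro!: exI[of _ 1])
  then have "(r * r) *\<^sub>R (b \<circ>\<^sub>J b) \<in> positive_cone"
    using r by (intro positive_cone_scaleR) auto
  then show ?thesis using r by (simp add: b_def jprod_simps)
qed

text \<open>Membership in the cone supplies only some radius; writing \<open>x\<close> as a square
  shows that every radius from \<open>norm x\<close> on will do. A radius depending continuously on
  \<open>x\<close> is what makes the cone closed.\<close>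

lemma positive_cone_norm_bound:
  assumes x: "x \<in> positive_cone" and g: "norm x \<le> g"
  shows "norm (g *\<^sub>R 1 - x) \<le> g"
proof (cases "g = 0")
  case True
  then show ?thesis using g by simp
next
  case False
  then have g0: "g > 0" using g norm_ge_zero[of x] by linarith
  obtain w where w: "w \<in> jalg x" "w \<circ>\<^sub>J w = x"
    by (rule positive_cone_ex_square_root[OF x self_in_jalg])
  have ws: "w \<in> self_adjoint"
    using jalg_self_adjoint[OF positive_cone_self_adjoint[OF x] w(1)] .
  then have "norm w ^ 2 \<le> g" using norm_jprod_self[OF ws] w g by simp
  then have "norm ((1 / sqrt g) *\<^sub>R w) \<le> 1"
    using g0 by (simp add: real_le_rsqrt)
  then have "norm (1 - (1 / g) *\<^sub>R x) \<le> 1"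
    using norm_one_minus_square_le[of "(1 / sqrt g) *\<^sub>R w"] ws w g0 by (simp add: jprod_simps)
  moreover have "g *\<^sub>R 1 - x = g *\<^sub>R (1 - (1 / g) *\<^sub>R x)"
    using g0 by (simp add: scaleR_diff_right)
  ultimately show ?thesis
    using g0 by (simp add: mult_left_le)
qed

lemma closed_positive_cone: "closed (positive_cone :: 'a::unital_jb_star_algebra set)"
proof -
  have "x \<in> positive_cone \<longleftrightarrow> x \<in> self_adjoint \<and> norm (norm x *\<^sub>R 1 - x) \<le> norm x" for x :: 'a
  proof
    assume "x \<in> self_adjoint \<and> norm (norm x *\<^sub>R 1 - x) \<le> norm x"
    then show "x \<in> positive_cone"
      unfolding positive_cone_def by (intro CollectI conjI exI[of _ "norm x"]) auto
  qed (use positive_cone_norm_bound[of x "norm x"] positive_cone_self_adjoint[of x] in auto)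
  then have "positive_cone = self_adjoint \<inter> {x::'a. norm (norm x *\<^sub>R 1 - x) \<le> norm x}"
    by blast
  moreover have "closed {x::'a. norm (norm x *\<^sub>R 1 - x) \<le> norm x}"
    by (intro closed_Collect_le continuous_intros)
  ultimately show ?thesis
    using closed_self_adjoint by (metis closed_Int)
qed

text \<open>Square roots v and w of the factors can be taken in the same associative subalgebra,
  where v^2 w^2 = (v w)^2.\<close>

lemma positive_cone_jprod:
  assumes y: "y \<in> self_adjoint" and x: "x \<in> positive_cone" "x \<in> jalg y"
    and z: "z \<in> positive_cone" "z \<in> jalg y"
  shows "x \<circ>\<^sub>J z \<in> positive_cone"
proof -
  obtain v where v: "v \<in> jalg y" "v \<circ>\<^sub>J v = x"
    by (rule positive_cone_ex_square_root[OF x])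
  obtain w where w: "w \<in> jalg y" "w \<circ>\<^sub>J w = z"
    by (rule positive_cone_ex_square_root[OF z])
  have "x \<circ>\<^sub>J z = v \<circ>\<^sub>J (v \<circ>\<^sub>J (w \<circ>\<^sub>J w))"
    using jalg_assoc[OF v(1) jalg_jprod[OF w(1) w(1)], of v] v w by simp
  also have "v \<circ>\<^sub>J (w \<circ>\<^sub>J w) = w \<circ>\<^sub>J (v \<circ>\<^sub>J w)"
    by (rule jalg_operators_commute[OF v(1) w(1)])
  also have "v \<circ>\<^sub>J (w \<circ>\<^sub>J (v \<circ>\<^sub>J w)) = (v \<circ>\<^sub>J w) \<circ>\<^sub>J (v \<circ>\<^sub>J w)"
    using jalg_assoc[OF v(1) jalg_jprod[OF v(1) w(1)], of w] by simp
  finally have "x \<circ>\<^sub>J z = (v \<circ>\<^sub>J w) \<circ>\<^sub>J (v \<circ>\<^sub>J w)" .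
  moreover have "v \<circ>\<^sub>J w \<in> self_adjoint"
    by (rule jalg_self_adjoint[OF y jalg_jprod[OF v(1) w(1)]])
  ultimately show ?thesis by simp
qed

text \<open>The product (1 - a)(1 + a) = 1 - a^2 is positive, hence a square w^2, and again a^2 +
  w^2 = 1 bounds the norm of \<open>a\<close>. Together with \<open>positive_cone_shift\<close> this
  identifies the norm with the order unit norm.\<close>

lemma norm_le_oneI:
  assumes "1 - a \<in> positive_cone" "1 + a \<in> positive_cone"
  shows "norm a \<le> 1"
proof -
  have a: "a \<in> self_adjoint"
    using positive_cone_self_adjoint[OF assms(2)] self_adjoint_diff[of "1 + a" 1] by simp
  have "(1 - a) \<circ>\<^sub>J (1 + a) \<in> positive_cone"
    by (rule positive_cone_jprod[OF a]) (use assms in auto)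
  then have "1 - a \<circ>\<^sub>J a \<in> positive_cone"
    by (simp add: jprod_simps)
  then obtain w where w: "w \<in> jalg a" "w \<circ>\<^sub>J w = 1 - a \<circ>\<^sub>J a"
    by (rule positive_cone_ex_square_root[OF _ jalg_diff[OF one_in_jalg jalg_jprod[OF self_in_jalg self_in_jalg]]])
  have "norm a ^ 2 \<le> 1"
    using norm_power2_le_sum_squares[OF a _ w(1), of a] norm_one_le[where 'a='a] w(2) by simp
  then show ?thesis
    by (simp add: power2_eq_square abs_square_le_1[of "norm a", simplified power2_eq_square, simplified])
qed

lemma norm_leI:
  assumes "g *\<^sub>R 1 - a \<in> positive_cone" "g *\<^sub>R 1 + a \<in> positive_cone" "g \<ge> 0"
  shows "norm a \<le> g"
proof (rule field_le_epsilon)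
  fix e :: real assume e: "e > 0"
  \<comment> \<open>The bound is enlarged so that division by it is possible even for g = 0.\<close>
  define h where "h = g + e"
  have h: "h > 0" using e assms(3) by (simp add: h_def)
  have "(g *\<^sub>R 1 - a) + e *\<^sub>R 1 \<in> positive_cone" "(g *\<^sub>R 1 + a) + e *\<^sub>R 1 \<in> positive_cone"
    using assms e by simp_all
  moreover have "(g *\<^sub>R 1 - a) + e *\<^sub>R 1 = h *\<^sub>R 1 - a" "(g *\<^sub>R 1 + a) + e *\<^sub>R 1 = h *\<^sub>R 1 + a"
    by (simp_all add: h_def algebra_simps)
  ultimately have "(1 / h) *\<^sub>R (h *\<^sub>R 1 - a) \<in> positive_cone" "(1 / h) *\<^sub>R (h *\<^sub>R 1 + a) \<in> positive_cone"
    using h by (auto intro!: positive_cone_scaleR)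
  then have "norm ((1 / h) *\<^sub>R a) \<le> 1"
    using h by (intro norm_le_oneI) (simp_all add: scaleR_diff_right scaleR_add_right)
  then show "norm a \<le> g + e" using h by (simp add: h_def)
qed

lemma positive_cone_antisym:
  assumes "x \<in> positive_cone" "- x \<in> positive_cone"
  shows "x = 0"
  using norm_leI[of 0 x] assms by simp

lemma positive_cone_minus_square:
  assumes "x \<in> positive_cone" "1 - x \<in> positive_cone"
  shows "x - x \<circ>\<^sub>J x \<in> positive_cone"
proof -
  have "x \<circ>\<^sub>J (1 - x) \<in> positive_cone"
    by (rule positive_cone_jprod[OF positive_cone_self_adjoint[OF assms(1)] assms(1) _ assms(2)])
      simp_all
  then show ?thesis by (simp add: jprod.diff_right)
qed

subsection \<open>Positive invertible elements are the interior points of the cone\<close>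

text \<open>Neumann series. That the inverse stays in \<open>jalg y\<close> matters: associativity
  there turns it into a Jordan inverse.\<close>

lemma jalg_ex_inverse_one_minus:
  assumes t: "t \<in> jalg y" and le: "norm t < 1"
  obtains d where "d \<in> jalg y" "(1 - t) \<circ>\<^sub>J d = 1"
proof -
  have n: "norm (jpow t n) \<le> norm t ^ n" for n
  proof (induction n)
    case (Suc n)
    then show ?case
      using norm_jprod_le[of t "jpow t n"] mult_left_mono[OF Suc norm_ge_zero[of t]] by simp
  qed (simp add: norm_one_le)
  have "summable (jpow t)"
    by (rule summable_comparison_test'[of "\<lambda>n. norm t ^ n" 0]) (use le n in \<open>auto simp: summable_geometric\<close>)
  then have lim: "(\<lambda>n. \<Sum>i<n. jpow t i) \<longlonglongrightarrow> suminf (jpow t)"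
    by (rule summable_LIMSEQ)
  have tel: "(1 - t) \<circ>\<^sub>J (\<Sum>i<n. jpow t i) = 1 - jpow t n" for n
  proof (induction n)
    case (Suc n)
    have "(1 - t) \<circ>\<^sub>J jpow t n = jpow t n - jpow t (Suc n)"
      by (simp add: jprod.diff_left)
    then show ?case
      by (simp only: sum.lessThan_Suc jprod.add_right Suc) simp
  qed (simp add: jprod.zero_right)
  have "jpow t \<longlonglongrightarrow> 0"
    by (rule Lim_null_comparison[OF _ LIMSEQ_power_zero[of "norm t"]]) (use le n in auto)
  then have "(\<lambda>n. 1 - jpow t n) \<longlonglongrightarrow> 1 - 0"
    by (intro tendsto_intros)
  moreover have "(\<lambda>n. (1 - t) \<circ>\<^sub>J (\<Sum>i<n. jpow t i)) \<longlonglongrightarrow> (1 - t) \<circ>\<^sub>J suminf (jpow t)"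
    by (intro jprod.tendsto lim tendsto_const)
  ultimately have "(1 - t) \<circ>\<^sub>J suminf (jpow t) = 1"
    unfolding tel using LIMSEQ_unique by fastforce
  moreover have "(\<Sum>i<n. jpow t i) \<in> jalg y" for n
    using subspace_jalg t by (intro subspace_sum) auto
  then have "suminf (jpow t) \<in> jalg y"
    using closed_sequentially[OF closed_jalg _ lim] by blast
  ultimately show ?thesis by (rule that[rotated])
qed

lemma jalg_ex_inverse:
  assumes x: "x \<in> jalg y" and d: "x - d *\<^sub>R 1 \<in> positive_cone" "d > 0"
  obtains e where "e \<in> jalg y" "x \<circ>\<^sub>J e = 1"
proof -
  obtain g where g: "g \<ge> 0" "norm (g *\<^sub>R 1 - (x - d *\<^sub>R 1)) \<le> g"
    using d by (auto simp: positive_cone_def)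
  \<comment> \<open>With this scale \<open>x\<close> equals h (1 - t), where the norm of t is at
    most g / h < 1.\<close>
  define h where "h = g + d"
  have h: "h > 0" using g d by (simp add: h_def)
  define t where "t = (1 / h) *\<^sub>R (g *\<^sub>R 1 - (x - d *\<^sub>R 1))"
  have "t \<in> jalg y" using x by (simp add: t_def)
  moreover have "norm t < 1"
    using h g d by (simp add: t_def h_def)
  ultimately obtain e where e: "e \<in> jalg y" "(1 - t) \<circ>\<^sub>J e = 1"
    by (rule jalg_ex_inverse_one_minus)
  have "1 - t = (1 / h) *\<^sub>R x"
  proof -
    have "g *\<^sub>R 1 - (x - d *\<^sub>R 1) = h *\<^sub>R 1 - x" by (simp add: h_def algebra_simps)
    then have "t = (1 / h) *\<^sub>R (h *\<^sub>R 1 - x)" by (simp only: t_def)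
    then show ?thesis using h by (simp add: scaleR_diff_right)
  qed
  then have "x \<circ>\<^sub>J ((1 / h) *\<^sub>R e) = 1" using e by (simp add: jprod_simps)
  then show ?thesis by (rule that[OF jalg_scaleR[OF e(1)]])
qed

lemma jordan_invertible_minus_scaleC:
  assumes x: "x \<in> positive_cone" and z: "z \<notin> complex_of_real ` {0..}"
  shows "jordan_invertible (x - z *\<^sub>C 1)"
proof -
  define w where "w = x - Re z *\<^sub>R 1"
  define s where "s = Im z"
  have w: "w \<in> jalg x" by (simp add: w_def)
  have wsa: "w \<in> self_adjoint" using x by (simp add: w_def positive_cone_self_adjoint)
  have xz: "x - z *\<^sub>C 1 = w - s *\<^sub>R (\<i> *\<^sub>C 1)"
    unfolding w_def s_def by (subst scaleC_complex[of z 1]) (simp add: diff_diff_eq)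
  show ?thesis
  proof (cases "s = 0")
    case True
    then have "Re z < 0"
      using z complex_is_Real_iff[of z] by (force simp: s_def image_iff complex_eq_iff)
    then have r: "- Re z > 0" by simp
    have "w - (- Re z) *\<^sub>R 1 \<in> positive_cone" using x by (simp add: w_def)
    then obtain e where e: "e \<in> jalg x" "w \<circ>\<^sub>J e = 1"
      by (rule jalg_ex_inverse[OF w _ r])
    have "(w \<circ>\<^sub>J w) \<circ>\<^sub>J e = w"
      using jalg_assoc[OF w e(1), of w] e by simp
    then show ?thesis using e True by (auto simp: jordan_invertible_def xz)
  next
    case False
    have "(w \<circ>\<^sub>J w + (s * s) *\<^sub>R 1) - (s * s) *\<^sub>R 1 \<in> positive_cone"
      using wsa by simp
    moreover have "s * s > 0" using False by (simp flip: power2_eq_square)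
    ultimately obtain d where d: "d \<in> jalg x" "(w \<circ>\<^sub>J w + (s * s) *\<^sub>R 1) \<circ>\<^sub>J d = 1"
      by (rule jalg_ex_inverse[OF jalg_add[OF jalg_jprod[OF w w] jalg_scaleR[OF one_in_jalg]]])
    have d1: "(w \<circ>\<^sub>J w) \<circ>\<^sub>J d = 1 - (s * s) *\<^sub>R d"
      using d(2) by (simp add: jprod_simps algebra_simps)
    have d2: "w \<circ>\<^sub>J (w \<circ>\<^sub>J d) = 1 - (s * s) *\<^sub>R d"
      using d1 jalg_assoc[OF w d(1), of w] by simp
    have d3: "(w \<circ>\<^sub>J w) \<circ>\<^sub>J (w \<circ>\<^sub>J d) = w - (s * s) *\<^sub>R (w \<circ>\<^sub>J d)"
      using jalg_operators_commute[of "w \<circ>\<^sub>J w" x w d] w d1 by (simp add: jprod_simps)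
    \<comment> \<open>The inverse of w - i s is (w + i s) / (w^2 + s^2), and \<open>d\<close> is the
      inverse of the denominator.\<close>
    define b where "b = w \<circ>\<^sub>J d + s *\<^sub>R (\<i> *\<^sub>C d)"
    have "(w - s *\<^sub>R (\<i> *\<^sub>C 1)) \<circ>\<^sub>J b = 1"
      by (simp add: b_def jprod_simps d2 scaleC_scaleR scaleC_diff_right scaleC_add_right
          scaleC_minus_right scaleR_add_right scaleR_diff_right)
    moreover have "((w - s *\<^sub>R (\<i> *\<^sub>C 1)) \<circ>\<^sub>J (w - s *\<^sub>R (\<i> *\<^sub>C 1))) \<circ>\<^sub>J b = w - s *\<^sub>R (\<i> *\<^sub>C 1)"
      by (simp add: b_def jprod_simps d1 d2 d3 scaleC_scaleR scaleC_diff_right scaleC_add_right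
          scaleC_minus_right scaleR_add_right scaleR_diff_right algebra_simps)
    ultimately show ?thesis by (auto simp: jordan_invertible_def xz)
  qed
qed

lemma inverse_jpow:
  fixes y :: "'a::unital_jb_star_algebra"
  assumes e: "y \<circ>\<^sub>J e = 1" "(y \<circ>\<^sub>J y) \<circ>\<^sub>J e = y"
  shows "e \<circ>\<^sub>J jpow y (Suc k) = jpow y k"
proof (induction k)
  case 0
  show ?case using e by (simp add: jprod_commute)
next
  case (Suc k)
  let ?x = "jpow y k"
  have e': "e \<circ>\<^sub>J y = 1" "e \<circ>\<^sub>J (y \<circ>\<^sub>J y) = y"
    using e by (simp_all add: jprod_commute)
  have "(e \<circ>\<^sub>J ?x) \<circ>\<^sub>J (y \<circ>\<^sub>J y) = e \<circ>\<^sub>J (?x \<circ>\<^sub>J (y \<circ>\<^sub>J y))"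
    using jordan_linearized[of y ?x y e] by (simp add: e)
  moreover have "(y \<circ>\<^sub>J y) \<circ>\<^sub>J (e \<circ>\<^sub>J ?x) + y \<circ>\<^sub>J ?x = 2 *\<^sub>R (y \<circ>\<^sub>J (e \<circ>\<^sub>J (y \<circ>\<^sub>J ?x)))"
    using jordan_linearized[of y e y ?x]
    by (simp add: e e' scaleR_2 jprod_commute[of ?x] jprod_commute[of "e \<circ>\<^sub>J ?x"] algebra_simps)
  moreover have "(y \<circ>\<^sub>J y) \<circ>\<^sub>J ?x = jpow y (Suc (Suc k))"
    using jpow_add[of y 2 k] by (simp add: numeral_2_eq_2)
  ultimately have "e \<circ>\<^sub>J jpow y (Suc (Suc k)) + y \<circ>\<^sub>J ?x = 2 *\<^sub>R (y \<circ>\<^sub>J ?x)"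
    using Suc by (metis jprod_commute jpow.simps(2))
  then show ?case by (simp add: scaleR_2)
qed

lemma inverse_jprod_jalg:
  fixes y :: "'a::unital_jb_star_algebra"
  assumes e: "y \<circ>\<^sub>J e = 1" "(y \<circ>\<^sub>J y) \<circ>\<^sub>J e = y" and q: "q \<in> jalg y"
  shows "e \<circ>\<^sub>J (y \<circ>\<^sub>J q) = q"
proof -
  have "closed {q. e \<circ>\<^sub>J (y \<circ>\<^sub>J q) = q}"
    by (intro closed_Collect_eq jprod.continuous_on continuous_intros)
  moreover have "subspace {q. e \<circ>\<^sub>J (y \<circ>\<^sub>J q) = q}"
    by (auto simp: subspace_def jprod_simps jprod.zero_right)
  ultimately have "jalg y \<subseteq> {q. e \<circ>\<^sub>J (y \<circ>\<^sub>J q) = q}"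
    by (rule jalg_minimal) (use inverse_jpow[OF e] in simp)
  then show ?thesis using q by blast
qed

lemma norm_jpow_power2:
  assumes "v \<in> self_adjoint" "norm v = 1"
  shows "norm (jpow v (2 ^ k)) = 1"
proof (induction k)
  case (Suc k)
  have "jpow v (2 ^ k) \<in> self_adjoint"
    using jalg_self_adjoint[OF assms(1)] by simp
  then show ?case
    using norm_jprod_self[of "jpow v (2 ^ k)"] Suc by (simp add: jpow_add mult_2)
qed (use assms in simp)

text \<open>If \<open>1 - y\<close> has norm 1, the elements \<open>q = (1 - y)\<^sup>n\<close> show that multiplication by \<open>y\<close> is
  not bounded below on the subalgebra generated by \<open>y\<close>.\<close>

lemma invertible_contraction_interior:
  fixes y :: "'a::unital_jb_star_algebra"
  assumes y: "y \<in> positive_cone" "norm y \<le> 1" and e: "y \<circ>\<^sub>J e = 1" "(y \<circ>\<^sub>J y) \<circ>\<^sub>J e = y"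
  shows "\<exists>d>0. y - d *\<^sub>R 1 \<in> positive_cone"
proof -
  have ysa: "y \<in> self_adjoint" using y by (simp add: positive_cone_self_adjoint)
  define v where "v = 1 - y"
  have v: "v \<in> jalg y" "v \<in> self_adjoint" using ysa by (simp_all add: v_def)
  have vp: "v \<in> positive_cone" using positive_cone_shift'[OF ysa y(2)] by (simp add: v_def)
  have v1: "norm v \<le> 1" using positive_cone_norm_bound[OF y] by (simp add: v_def)
  have "norm v < 1"
  proof (rule ccontr)
    assume "\<not> norm v < 1"
    then have nv: "norm v = 1" using v1 by simp
    have vj: "jpow v j \<in> positive_cone" for j
    proof (induction j)
      case (Suc j)
      then show ?case
        using positive_cone_jprod[OF ysa vp v(1) _ jalg_jpow[OF v(1)]] by simp
    qed simp
    \<comment> \<open>Since y = 1 - v, the elements y v^j with j < n sum to 1 - v^n, and they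
      decrease in j; so n copies of y v^n lie below 1.\<close>
    have main: "real n * norm (y \<circ>\<^sub>J jpow v n) \<le> 1" for n
    proof -
      have dec: "y \<circ>\<^sub>J jpow v j - y \<circ>\<^sub>J jpow v n \<in> positive_cone" if "j \<le> n" for j
        using that
      proof (induction n rule: dec_induct)
        case (step k)
        have "y \<circ>\<^sub>J jpow v k - y \<circ>\<^sub>J jpow v (Suc k) = y \<circ>\<^sub>J (y \<circ>\<^sub>J jpow v k)"
          by (simp add: v_def jprod_simps)
        also have "\<dots> = (y \<circ>\<^sub>J y) \<circ>\<^sub>J jpow v k"
          using jalg_assoc[of y y "jpow v k" y] v by simp
        also have "\<dots> \<in> positive_cone"
          using ysa v by (intro positive_cone_jprod[OF ysa _ _ vj]) auto
        finally show ?case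
          using positive_cone_add[OF step.IH] by fastforce
      qed simp
      have "(\<Sum>j<n. y \<circ>\<^sub>J jpow v j - y \<circ>\<^sub>J jpow v n) \<in> positive_cone"
        by (rule positive_cone_sum) (use dec in auto)
      moreover have "(\<Sum>j<m. y \<circ>\<^sub>J jpow v j) = 1 - jpow v m" for m
        by (induction m) (simp_all add: v_def jprod_simps)
      ultimately have "1 - jpow v n - real n *\<^sub>R (y \<circ>\<^sub>J jpow v n) \<in> positive_cone"
        by (simp add: sum_subtractf sum_constant_scaleR)
      from positive_cone_add[OF this vj[of n]]
      have "1 - real n *\<^sub>R (y \<circ>\<^sub>J jpow v n) \<in> positive_cone" by simp
      moreover have "y \<circ>\<^sub>J jpow v n \<in> positive_cone"
        using y v vj by (intro positive_cone_jprod[OF ysa]) auto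
      then have "1 + real n *\<^sub>R (y \<circ>\<^sub>J jpow v n) \<in> positive_cone" by simp
      ultimately have "norm (real n *\<^sub>R (y \<circ>\<^sub>J jpow v n)) \<le> 1"
        by (rule norm_le_oneI)
      then show ?thesis by simp
    qed
    \<comment> \<open>Exponents that are powers of two are taken because repeated squaring keeps
      their norms equal to 1; multiplying y v^n by the inverse \<open>e\<close> recovers
      v^n.\<close>
    have "2 ^ k \<le> norm e" for k
    proof -
      have "jpow v (2 ^ k) = e \<circ>\<^sub>J (y \<circ>\<^sub>J jpow v (2 ^ k))"
        using inverse_jprod_jalg[OF e, of "jpow v (2 ^ k)"] v by simp
      then have "1 \<le> norm e * norm (y \<circ>\<^sub>J jpow v (2 ^ k))"
        using norm_jpow_power2[OF v(2) nv, of k] norm_jprod_le by metis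
      then have "2 ^ k * 1 \<le> 2 ^ k * (norm e * norm (y \<circ>\<^sub>J jpow v (2 ^ k)))"
        by (intro mult_left_mono) auto
      also have "\<dots> = norm e * (real (2 ^ k) * norm (y \<circ>\<^sub>J jpow v (2 ^ k)))" by simp
      also have "\<dots> \<le> norm e * 1" by (intro mult_left_mono main) auto
      finally show ?thesis by simp
    qed
    moreover obtain k where "norm e < 2 ^ k"
      using real_arch_pow[of 2 "norm e"] by auto
    ultimately show False by (meson not_le)
  qed
  moreover have "norm v *\<^sub>R 1 - (y - (1 - norm v) *\<^sub>R 1) = v"
    by (simp add: v_def algebra_simps)
  then have "y - (1 - norm v) *\<^sub>R 1 \<in> positive_cone"
    using ysa by (auto simp: positive_cone_def intro!: exI[of _ "norm v"])
  ultimately show ?thesis by (intro exI[of _ "1 - norm v"]) auto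
qed

lemma invertible_positive_interior:
  assumes y: "y \<in> positive_cone" and inv: "jordan_invertible y"
  shows "\<exists>d>0. y - d *\<^sub>R 1 \<in> positive_cone"
proof -
  obtain e where e: "y \<circ>\<^sub>J e = 1" "(y \<circ>\<^sub>J y) \<circ>\<^sub>J e = y"
    using inv by (auto simp: jordan_invertible_def)
  define r where "r = norm y + 1"
  have r: "r > 0" by (simp add: r_def add_nonneg_pos)
  have "\<exists>d>0. (1 / r) *\<^sub>R y - d *\<^sub>R 1 \<in> positive_cone"
    by (rule invertible_contraction_interior[of _ "r *\<^sub>R e"])
      (use y r e in \<open>auto simp: jprod_simps r_def\<close>)
  then obtain d where d: "d > 0" "(1 / r) *\<^sub>R y - d *\<^sub>R 1 \<in> positive_cone" by blast
  have "r *\<^sub>R ((1 / r) *\<^sub>R y - d *\<^sub>R 1) \<in> positive_cone"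
    using d r by (intro positive_cone_scaleR) auto
  then have "y - (r * d) *\<^sub>R 1 \<in> positive_cone"
    using r by (simp add: scaleR_diff_right)
  then show ?thesis using r d by (intro exI[of _ "r * d"]) auto
qed

text \<open>To pass from the spectrum to the cone, take the largest m with x - m 1 in the cone. This
  element is positive but not interior, hence not invertible, so m is a spectral value and
  nonnegative; invertibility of x excludes m = 0.\<close>

lemma positive_invertibles_eq:
  "positive_invertibles = {x::'a::unital_jb_star_algebra. \<exists>d>0. x - d *\<^sub>R 1 \<in> positive_cone}"
proof (intro set_eqI iffI)
  fix x :: 'a assume "x \<in> {x. \<exists>d>0. x - d *\<^sub>R 1 \<in> positive_cone}"
  then obtain d where d: "d > 0" "x - d *\<^sub>R 1 \<in> positive_cone" by blast
  have x: "x \<in> positive_cone"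
    using positive_cone_add[OF d(2) positive_cone_one[of d]] d(1) by simp
  obtain e where e: "e \<in> jalg x" "x \<circ>\<^sub>J e = 1"
    by (rule jalg_ex_inverse[OF self_in_jalg d(2,1)])
  have "(x \<circ>\<^sub>J x) \<circ>\<^sub>J e = x"
    using jalg_assoc[OF self_in_jalg e(1), of x] e by simp
  then have "jordan_invertible x" using e by (auto simp: jordan_invertible_def)
  moreover have "jordan_spectrum x \<subseteq> complex_of_real ` {0..}"
    using jordan_invertible_minus_scaleC[OF x] by (auto simp: jordan_spectrum_def)
  ultimately show "x \<in> positive_invertibles"
    using positive_cone_self_adjoint[OF x]
    by (simp add: positive_invertibles_def jordan_positive_def self_adjoint_def)
next
  fix x :: 'a assume "x \<in> positive_invertibles"
  then have x: "x \<in> self_adjoint" and sp: "jordan_spectrum x \<subseteq> complex_of_real ` {0..}"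
    and inv: "jordan_invertible x"
    by (auto simp: positive_invertibles_def jordan_positive_def self_adjoint_def)
  have "\<exists>d>0. x - d *\<^sub>R 1 \<in> positive_cone"
  proof (cases "(1::'a) = 0")
    \<comment> \<open>In the zero algebra the set of admissible shifts is unbounded and has no
      supremum.\<close>
    case True
    then have "z = 0" for z :: 'a by (metis one_jprod jprod.zero_left)
    then have "x - 1 *\<^sub>R 1 = 0" by blast
    then show ?thesis by (metis positive_cone_zero zero_less_one)
  next
    case False
    define S where "S = {m. x - m *\<^sub>R 1 \<in> positive_cone}"
    have "- norm x \<in> S" using positive_cone_shift[OF x order_refl] by (simp add: S_def)
    then have ne: "S \<noteq> {}" by blast
    have "m \<le> norm x" if "m \<in> S" for m
    proof (rule ccontr)
      assume m: "\<not> m \<le> norm x"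
      have "(x - m *\<^sub>R 1) + (norm x *\<^sub>R 1 - x) \<in> positive_cone"
        using that positive_cone_shift'[OF x order_refl] unfolding S_def
        by (intro positive_cone_add) auto
      then have "(1 / (m - norm x)) *\<^sub>R ((x - m *\<^sub>R 1) + (norm x *\<^sub>R 1 - x)) \<in> positive_cone"
        using m by (intro positive_cone_scaleR) auto
      moreover have "(1 / (m - norm x)) *\<^sub>R ((x - m *\<^sub>R 1) + (norm x *\<^sub>R 1 - x)) = - 1"
      proof -
        define k where "k = m - norm x"
        have "(x - m *\<^sub>R 1) + (norm x *\<^sub>R 1 - x) = (- k) *\<^sub>R 1"
          by (simp add: k_def algebra_simps)
        moreover have "k \<noteq> 0" using m by (simp add: k_def)
        ultimately show ?thesis unfolding k_def[symmetric] by simp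
      qed
      ultimately show False
        using positive_cone_antisym[of "1::'a"] False by simp
    qed
    then have bdd: "bdd_above S" by (meson bdd_aboveI)
    have "closed S"
    proof -
      have "S = (\<lambda>m. x - m *\<^sub>R 1) -` positive_cone" by (auto simp: S_def)
      then show ?thesis
        by (simp add: closed_vimage closed_positive_cone continuous_intros)
    qed
    then have SupS: "Sup S \<in> S" using closed_contains_Sup[OF ne bdd] by blast
    have ninv: "\<not> jordan_invertible (x - Sup S *\<^sub>R 1)"
    proof
      assume "jordan_invertible (x - Sup S *\<^sub>R 1)"
      then obtain d where d: "d > 0" "(x - Sup S *\<^sub>R 1) - d *\<^sub>R 1 \<in> positive_cone"
        using invertible_positive_interior SupS unfolding S_def by blast
      then have "Sup S + d \<in> S" by (simp add: S_def algebra_simps)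
      then show False using cSup_upper[OF _ bdd] d by fastforce
    qed
    then have "complex_of_real (Sup S) \<in> jordan_spectrum x"
      by (simp add: jordan_spectrum_def scaleC_of_real)
    then have "Sup S \<ge> 0" using sp by auto
    moreover have "Sup S \<noteq> 0" using ninv inv by auto
    ultimately show ?thesis using SupS by (intro exI[of _ "Sup S"]) (auto simp: S_def)
  qed
  then show "x \<in> {x. \<exists>d>0. x - d *\<^sub>R 1 \<in> positive_cone}" by blast
qed

subsection \<open>Metric midpoints\<close>

text \<open>Only distances enter the recursion, so isometries carry cores to cores. The number
  \<open>D\<close> stands for a bound on the diameter of \<open>A\<close>, which is halved at every
  stage.\<close>

primrec metric_core :: "real \<Rightarrow> 'a::metric_space set \<Rightarrow> nat \<Rightarrow> 'a set" where
  "metric_core D A 0 = A"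
| "metric_core D A (Suc n) =
     {u \<in> metric_core D A n. \<forall>v\<in>metric_core D A n. dist u v \<le> D / 2 ^ Suc n}"

text \<open>A point of the core and its reflection in \<open>m\<close> are twice as far apart as the
  point and \<open>m\<close>. So \<open>m\<close> is within half the diameter bound of all points
  and survives to the next core.\<close>

lemma metric_core_symmetric:
  fixes m :: "'a::real_normed_vector"
  assumes sym: "\<And>u. u \<in> A \<Longrightarrow> 2 *\<^sub>R m - u \<in> A" and m: "m \<in> A"
    and diam: "\<And>u v. u \<in> A \<Longrightarrow> v \<in> A \<Longrightarrow> dist u v \<le> D"
  shows "m \<in> metric_core D A n"
    and "u \<in> metric_core D A n \<Longrightarrow> 2 *\<^sub>R m - u \<in> metric_core D A n"
    and "u \<in> metric_core D A n \<Longrightarrow> v \<in> metric_core D A n \<Longrightarrow> dist u v \<le> D / 2 ^ n"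
proof -
  have "m \<in> metric_core D A n \<and>
      (\<forall>u\<in>metric_core D A n. 2 *\<^sub>R m - u \<in> metric_core D A n) \<and>
      (\<forall>u\<in>metric_core D A n. \<forall>v\<in>metric_core D A n. dist u v \<le> D / 2 ^ n)"
  proof (induction n)
    case 0
    show ?case using assms by auto
  next
    case (Suc n)
    let ?C = "metric_core D A n"
    have m': "dist m v \<le> D / 2 ^ Suc n" if "v \<in> ?C" for v
    proof -
      have "dist (2 *\<^sub>R m - v) v = 2 * dist m v"
        by (metis (no_types, opaque_lifting) abs_numeral diff_diff_eq dist_norm norm_scaleR
            scaleR_2 scaleR_diff_right)
      moreover have "dist (2 *\<^sub>R m - v) v \<le> D / 2 ^ n" using Suc that by blast
      ultimately show ?thesis by (simp add: field_simps)
    qed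
    have s': "dist (2 *\<^sub>R m - u) v \<le> D / 2 ^ Suc n"
      if "u \<in> metric_core D A (Suc n)" "v \<in> ?C" for u v
    proof -
      have "dist (2 *\<^sub>R m - u) v = dist u (2 *\<^sub>R m - v)"
        by (simp add: dist_norm norm_minus_commute algebra_simps)
      then show ?thesis using Suc that by auto
    qed
    show ?case using Suc m' s' by auto
  qed
  then show "m \<in> metric_core D A n"
    and "u \<in> metric_core D A n \<Longrightarrow> 2 *\<^sub>R m - u \<in> metric_core D A n"
    and "u \<in> metric_core D A n \<Longrightarrow> v \<in> metric_core D A n \<Longrightarrow> dist u v \<le> D / 2 ^ n"
    by blast+
qed

lemma metric_core_subset: "metric_core D A n \<subseteq> A"
  by (induction n) auto

lemma metric_core_image:
  assumes iso: "\<And>u v. u \<in> A \<Longrightarrow> v \<in> A \<Longrightarrow> dist (f u) (f v) = dist u v"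
  shows "f ` metric_core D A n = metric_core D (f ` A) n"
proof (induction n)
  case (Suc n)
  have "metric_core D (f ` A) (Suc n) = {w \<in> f ` metric_core D A n.
      \<forall>v\<in>f ` metric_core D A n. dist w v \<le> D / 2 ^ Suc n}"
    by (simp add: Suc)
  also have "\<dots> = f ` metric_core D A (Suc n)"
    using metric_core_subset[of D A n] iso by (auto simp: subset_iff image_iff)
  finally show ?case by simp
qed simp

text \<open>The centre of symmetry is the only common point of the metric cores.\<close>

lemma isometry_center:
  fixes f :: "'a::real_normed_vector \<Rightarrow> 'b::real_normed_vector"
  assumes iso: "\<And>u v. u \<in> A \<Longrightarrow> v \<in> A \<Longrightarrow> dist (f u) (f v) = dist u v"
    and sym: "\<And>u. u \<in> A \<Longrightarrow> 2 *\<^sub>R m - u \<in> A" and m: "m \<in> A"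
    and diam: "\<And>u v. u \<in> A \<Longrightarrow> v \<in> A \<Longrightarrow> dist u v \<le> D"
    and sym': "\<And>u. u \<in> f ` A \<Longrightarrow> 2 *\<^sub>R m' - u \<in> f ` A" and m': "m' \<in> f ` A"
  shows "f m = m'"
proof -
  have diam': "dist u v \<le> D" if "u \<in> f ` A" "v \<in> f ` A" for u v
    using that iso diam by auto
  have "dist (f m) m' \<le> D * (1 / 2) ^ n" for n
  proof -
    have "f m \<in> metric_core D (f ` A) n"
      using metric_core_symmetric(1)[OF sym m diam, where n=n] metric_core_image[of A f, OF iso] by blast
    then show ?thesis
      using metric_core_symmetric(3)[OF sym' m' diam', of "f m" n m']
        metric_core_symmetric(1)[OF sym' m' diam', of n] by (simp add: power_one_over field_simps)
  qed
  moreover have "(\<lambda>n. D * (1 / 2) ^ n) \<longlonglongrightarrow> D * 0"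
    by (intro tendsto_intros LIMSEQ_power_zero) auto
  ultimately have "dist (f m) m' \<le> D * 0"
    by (intro LIMSEQ_le_const) auto
  then show ?thesis by simp
qed

text \<open>The deviation \<open>e\<close> from linearity is additive and vanishes on the integers,
  so e (n t) depends only on the fractional part of n t and is bounded; but it equals n times e
  t.\<close>

lemma additive_bounded_imp_linear:
  fixes g :: "real \<Rightarrow> 'a::real_normed_vector"
  assumes add: "\<And>s t. g (s + t) = g s + g t" and bd: "\<And>t. norm (g t) \<le> K * \<bar>t\<bar>"
  shows "g t = t *\<^sub>R g 1"
proof -
  define e where "e t = g t - t *\<^sub>R g 1" for t
  have ea: "e (s + t) = e s + e t" for s t
    by (simp add: e_def add algebra_simps)
  have e0: "e 0 = 0" using ea[of 0 0] by simp
  have en: "e (real n * t) = real n *\<^sub>R e t" for n t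
    by (induction n) (simp_all add: e0 ea distrib_right scaleR_left_distrib)
  have em: "e (- t) = - e t" for t
    using ea[of t "- t"] e0 by (simp add: eq_neg_iff_add_eq_0 add.commute)
  have e1: "e 1 = 0" by (simp add: e_def)
  have ei: "e (of_int k) = 0" for k
  proof (cases k rule: int_cases2)
    case (nonneg n)
    then show ?thesis using en[of n 1] e1 by simp
  next
    case (nonpos n)
    then show ?thesis using en[of n 1] e1 em[of "real n"] by simp
  qed
  have K: "0 \<le> K" using bd[of 1] norm_ge_zero[of "g 1"] by linarith
  have le: "norm (e s) \<le> 2 * K" if "\<bar>s\<bar> \<le> 1" for s
  proof -
    have "norm (e s) \<le> norm (g s) + \<bar>s\<bar> * norm (g 1)"
      unfolding e_def by (metis norm_scaleR norm_triangle_ineq4)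
    also have "\<dots> \<le> K * 1 + 1 * K"
      using bd[of s] bd[of 1] that K
      by (intro add_mono mult_mono) (auto intro: order_trans[OF _ mult_left_le])
    finally show ?thesis by simp
  qed
  have "real n * norm (e t) \<le> 2 * K" for n
  proof -
    have "real n *\<^sub>R e t = e (frac (real n * t)) + e (of_int \<lfloor>real n * t\<rfloor>)"
      unfolding en[symmetric] ea[symmetric] by (simp add: frac_def)
    then have "real n *\<^sub>R e t = e (frac (real n * t))" by (simp add: ei)
    then show ?thesis
      using le[of "frac (real n * t)"] frac_lt_1[of "real n * t"] frac_ge_0[of "real n * t"]
      by (metis abs_of_nat abs_of_nonneg less_imp_le norm_scaleR)
  qed
  then have "norm (e t) = 0"
    by (metis linorder_not_le norm_ge_zero order_le_less reals_Archimedean3)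
  then show ?thesis by (simp add: e_def)
qed

subsection \<open>Symmetric bilinear maps of infinitesimal isometries vanish\<close>

text \<open>The field \<open>X(u) = B(u, u) - w\<close> with \<open>w = B(h, h)\<close> vanishes at \<open>h\<close> and \<open>-h\<close> and is even, and
  \<open>X(u) - X(v) = B(u + v, u - v)\<close>, so its flow is isometric. Hence the trajectory \<open>x\<close> with
  \<open>x(0) = 0\<close> is odd and \<open>norm (x (2 t)) = norm (x t - x (- t)) = 2 * norm (x t)\<close>; since it stays at
  distance \<open>norm h\<close> from \<open>h\<close>, it is constant and \<open>w = 0\<close>. The proof follows the flow by explicit
  Euler steps \<open>F d\<close>, whose errors are of second order.\<close>

locale infinitesimal_isometries =
  fixes E :: "'a::real_normed_vector set" and B :: "'a \<Rightarrow> 'a \<Rightarrow> 'a" and K :: real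
  assumes subspace_E: "subspace E"
    and B_in: "a \<in> E \<Longrightarrow> b \<in> E \<Longrightarrow> B a b \<in> E"
    and B_sym: "a \<in> E \<Longrightarrow> b \<in> E \<Longrightarrow> B a b = B b a"
    and B_add: "a \<in> E \<Longrightarrow> b \<in> E \<Longrightarrow> c \<in> E \<Longrightarrow> B a (b + c) = B a b + B a c"
    and B_bound: "a \<in> E \<Longrightarrow> b \<in> E \<Longrightarrow> norm (B a b) \<le> K * norm a * norm b"
    and B_isometric: "a \<in> E \<Longrightarrow> b \<in> E \<Longrightarrow>
           norm (b + t *\<^sub>R B a b) \<le> (1 + K * t ^ 2 * norm a ^ 2) * norm b"
    and K_nonneg: "K \<ge> 0"
begin

lemma E_simps [simp]:
  "a \<in> E \<Longrightarrow> b \<in> E \<Longrightarrow> a + b \<in> E" "a \<in> E \<Longrightarrow> b \<in> E \<Longrightarrow> a - b \<in> E"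
  "a \<in> E \<Longrightarrow> t *\<^sub>R a \<in> E" "a \<in> E \<Longrightarrow> - a \<in> E" "0 \<in> E"
  using subspace_E
  by (auto simp: subspace_add subspace_diff subspace_scale subspace_neg subspace_0)

lemma B_minus: "a \<in> E \<Longrightarrow> b \<in> E \<Longrightarrow> B a (- b) = - B a b"
  using B_add[of a b "- b"] B_add[of a 0 0] by (simp add: eq_neg_iff_add_eq_0 add.commute)

lemma B_square_diff:
  assumes "u \<in> E" "v \<in> E"
  shows "B u u - B v v = B (u + v) (u - v)"
proof -
  have "B (u + v) (u - v) = B (u + v) u - B (u + v) v"
    using assms B_add[of "u + v" u "- v"] by (simp add: B_minus)
  also have "\<dots> = B u u - B v v"
    using assms B_sym[of "u + v"] B_sym[of u v] B_add[of u u v] B_add[of v u v] by simp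
  finally show ?thesis by simp
qed

context
  fixes h :: 'a
  assumes h: "h \<in> E"
begin

section \<open>Euler steps of the quadratic field and the growth of their errors\<close>

definition "w = B h h"
text \<open>As long as the accumulated factor is at most 2, orbits starting at 0 stay within 2 *
  norm h of \<open>h\<close>, hence in the ball of this radius about 0.\<close>

definition "R = 3 * norm h"
definition "F d u = u + d *\<^sub>R (B u u - w)"

lemma w_in [simp]: "w \<in> E"
  by (simp add: w_def B_in h)

lemma F_in [simp]: "u \<in> E \<Longrightarrow> F d u \<in> E"
  by (simp add: F_def B_in)

lemma funpow_F_in [simp]: "u \<in> E \<Longrightarrow> (F d ^^ j) u \<in> E"
  by (induction j) auto

lemma R_nonneg: "R \<ge> 0"
  by (simp add: R_def)

lemma F_h [simp]: "F d h = h"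
  by (simp add: F_def w_def)

lemma F_minus: "u \<in> E \<Longrightarrow> F (- d) (- u) = - F d u"
  using B_sym[of "- u" u] by (simp add: F_def B_minus algebra_simps)

lemma funpow_F_minus: "(F (- d) ^^ j) 0 = - (F d ^^ j) 0"
proof (induction j)
  case (Suc j)
  then show ?case using F_minus[of "(F d ^^ j) 0" d] by simp
qed simp

text \<open>Lipschitz factor of a single step on the ball of radius \<open>R\<close>, where u + v
  has norm at most 2 * R. It exceeds 1 only to second order in \<open>d\<close>.\<close>

definition "q d = 1 + 4 * K * R ^ 2 * d ^ 2"

lemma q_ge_1: "q d \<ge> 1"
  using K_nonneg by (simp add: q_def)

lemma q_minus [simp]: "q (- d) = q d"
  by (simp add: q_def)

lemma F_lipschitz:
  assumes "u \<in> E" "v \<in> E" "norm u \<le> R" "norm v \<le> R"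
  shows "norm (F d u - F d v) \<le> q d * norm (u - v)"
proof -
  have "F d u - F d v = (u - v) + d *\<^sub>R (B u u - B v v)"
    by (simp add: F_def algebra_simps)
  also have "\<dots> = (u - v) + d *\<^sub>R B (u + v) (u - v)"
    using assms by (simp add: B_square_diff)
  finally have "norm (F d u - F d v) \<le> (1 + K * d ^ 2 * norm (u + v) ^ 2) * norm (u - v)"
    using B_isometric[of "u + v" "u - v" d] assms by simp
  also have "\<dots> \<le> (1 + K * d ^ 2 * (2 * R) ^ 2) * norm (u - v)"
    using assms norm_triangle_ineq[of u v] K_nonneg
    by (intro mult_right_mono add_left_mono mult_left_mono power_mono) auto
  finally show ?thesis by (simp add: q_def power_mult_distrib algebra_simps)
qed

text \<open>The defect is \<open>d\<close> times the difference of the field at \<open>u\<close> and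
  at \<open>F d u\<close>, two points whose distance is itself of order \<open>d\<close>.\<close>

lemma F_almost_inverse:
  assumes "u \<in> E" "norm u \<le> R" "norm (F d u) \<le> R"
  shows "norm (F (- d) (F d u) - u) \<le> 4 * K ^ 2 * R ^ 3 * d ^ 2"
proof -
  have hR: "norm h \<le> R" by (simp add: R_def)
  have "u - F d u = - d *\<^sub>R (B u u - B h h)"
    by (simp add: F_def w_def)
  moreover have "norm (B u u) \<le> K * R * R" "norm (B h h) \<le> K * R * R"
    using assms h hR K_nonneg R_nonneg
    by (auto intro!: order_trans[OF B_bound] mult_mono)
  then have "norm (B u u - B h h) \<le> 2 * (K * R * R)"
    using norm_triangle_ineq4[of "B u u" "B h h"] by linarith
  ultimately have uF: "norm (u - F d u) \<le> \<bar>d\<bar> * (2 * (K * R * R))"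
    by (simp add: mult_left_mono)
  have "F (- d) (F d u) - u = d *\<^sub>R (B u u - B (F d u) (F d u))"
    by (simp add: F_def[of "- d"] algebra_simps) (simp add: F_def algebra_simps)
  also have "\<dots> = d *\<^sub>R B (u + F d u) (u - F d u)"
    using assms by (simp add: B_square_diff)
  finally have "norm (F (- d) (F d u) - u) = \<bar>d\<bar> * norm (B (u + F d u) (u - F d u))"
    by simp
  also have "\<dots> \<le> \<bar>d\<bar> * (K * norm (u + F d u) * norm (u - F d u))"
    using assms by (intro mult_left_mono B_bound) auto
  also have "\<dots> \<le> \<bar>d\<bar> * (K * (2 * R) * (\<bar>d\<bar> * (2 * (K * R * R))))"
    using assms uF norm_triangle_ineq[of u "F d u"] K_nonneg R_nonneg
    by (intro mult_left_mono mult_mono) auto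
  also have "\<dots> = 4 * K ^ 2 * R ^ 3 * (\<bar>d\<bar> * \<bar>d\<bar>)"
    by (simp add: power2_eq_square power3_eq_cube)
  finally show ?thesis by (simp add: power2_eq_square)
qed

text \<open>Region that k steps from 0 cannot leave: \<open>h\<close> is a fixed point, and every
  step stretches the distance to it by at most \<open>q d\<close>.\<close>

definition "level d k = {u \<in> E. norm (u - h) \<le> q d ^ k * norm h}"

lemma level_minus [simp]: "level (- d) k = level d k"
  by (simp add: level_def)

lemma zero_in_level: "0 \<in> level d k"
  using one_le_power[OF q_ge_1[of d], of k] mult_right_mono[of 1 "q d ^ k" "norm h"]
  by (simp add: level_def)

context
  fixes d :: real and L :: nat
  assumes small: "q d ^ L \<le> 2"
begin

lemma q_power_le:
  assumes "k \<le> L"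
  shows "q d ^ k \<le> 2"
  using power_increasing[OF assms q_ge_1[of d]] small by linarith

lemma level_norm_le:
  assumes "u \<in> level d k" "k \<le> L"
  shows "norm u \<le> R"
proof -
  have "norm (u - h) \<le> 2 * norm h"
    using assms mult_right_mono[OF q_power_le[OF assms(2)], of "norm h"] by (auto simp: level_def)
  then show ?thesis
    using norm_triangle_ineq[of "u - h" h] by (simp add: R_def)
qed

lemma F_level:
  assumes u: "u \<in> level d k" and k: "k \<le> L" and s: "s = d \<or> s = - d"
  shows "F s u \<in> level d (Suc k)"
proof -
  have "norm h \<le> R" by (simp add: R_def)
  then have "norm (F s u - F s h) \<le> q s * norm (u - h)"
    using level_norm_le[OF u k] u h by (intro F_lipschitz) (auto simp: level_def)
  also have "\<dots> \<le> q d * (q d ^ k * norm h)"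
    using u s q_ge_1[of d] by (auto simp: level_def intro!: mult_left_mono)
  finally show ?thesis using u by (simp add: level_def)
qed

lemma funpow_level:
  assumes u: "u \<in> level d k" and k: "k + j \<le> L" and s: "s = d \<or> s = - d"
  shows "(F s ^^ j) u \<in> level d (k + j)"
  using k
proof (induction j)
  case (Suc j)
  then show ?case using F_level[of "(F s ^^ j) u" "k + j" s] s by simp
qed (use u in simp)

lemma funpow_lipschitz:
  assumes u: "u \<in> level d k" and v: "v \<in> level d k" and k: "k + j \<le> L" and s: "s = d \<or> s = - d"
  shows "norm ((F s ^^ j) u - (F s ^^ j) v) \<le> q d ^ j * norm (u - v)"
  using k
proof (induction j)
  case (Suc j)
  let ?u = "(F s ^^ j) u" and ?v = "(F s ^^ j) v"
  have l: "?u \<in> level d (k + j)" "?v \<in> level d (k + j)"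
    using funpow_level u v s Suc.prems by auto
  then have "norm (F s ?u - F s ?v) \<le> q s * norm (?u - ?v)"
    using level_norm_le[of _ "k + j"] Suc.prems by (intro F_lipschitz) (auto simp: level_def)
  also have "\<dots> \<le> q d * (q d ^ j * norm (u - v))"
    using Suc s q_ge_1[of d] by (auto intro!: mult_left_mono)
  finally show ?case by simp
qed simp

text \<open>The innermost pair of a forward and a backward step is cancelled first. Its defect is
  carried through the remaining backward steps, which at most double it; this is the factor 8 = 2 *
  4.\<close>

lemma funpow_almost_inverse:
  assumes u: "u \<in> level d k" and k: "k + 2 * j \<le> L"
  shows "norm ((F (- d) ^^ j) ((F d ^^ j) u) - u) \<le> real j * (8 * K ^ 2 * R ^ 3 * d ^ 2)"
  using k
proof (induction j)
  case (Suc j)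
  let ?p = "(F d ^^ j) u" and ?G = "F (- d)"
  have p: "?p \<in> level d (k + j)" using funpow_level[OF u, of j d] Suc.prems by simp
  have Fp: "F d ?p \<in> level d (Suc (k + j))" using F_level[OF p, of d] Suc.prems by simp
  have GFp: "?G (F d ?p) \<in> level d (Suc (Suc (k + j)))"
    using F_level[OF Fp, of "- d"] Suc.prems by simp
  have p': "?p \<in> level d (Suc (Suc (k + j)))"
  proof -
    have "q d ^ (k + j) * norm h \<le> q d ^ (Suc (Suc (k + j))) * norm h"
      by (intro mult_right_mono power_increasing q_ge_1) auto
    then show ?thesis using p by (auto simp: level_def)
  qed
  have "norm ((?G ^^ j) (?G (F d ?p)) - (?G ^^ j) ?p) \<le> q d ^ j * norm (?G (F d ?p) - ?p)"
    using Suc.prems by (intro funpow_lipschitz[OF GFp p']) auto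
  also have "\<dots> \<le> 2 * (4 * K ^ 2 * R ^ 3 * d ^ 2)"
    using p Suc.prems level_norm_le[OF p] level_norm_le[OF Fp]
    by (intro mult_mono q_power_le F_almost_inverse) (auto simp: level_def)
  finally have "norm ((?G ^^ Suc j) ((F d ^^ Suc j) u) - (?G ^^ j) ?p) \<le> 8 * K ^ 2 * R ^ 3 * d ^ 2"
    by (simp add: funpow_swap1)
  moreover have "norm ((?G ^^ j) ?p - u) \<le> real j * (8 * K ^ 2 * R ^ 3 * d ^ 2)"
    using Suc by simp
  ultimately show ?case
    using norm_triangle_ineq[of "(?G ^^ Suc j) ((F d ^^ Suc j) u) - (?G ^^ j) ?p" "(?G ^^ j) ?p - u"]
    by (simp add: algebra_simps)
qed simp

text \<open>Going back \<open>j\<close> steps nearly takes the point at time 2 * j to the point at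
  time \<open>j\<close>, and takes 0 to the negative of the latter. The backward steps expand
  distances by at most the given power of \<open>q d\<close>. The budget 3 * j counts 2 * j steps
  forward and \<open>j\<close> back.\<close>

lemma norm_orbit_double:
  assumes j: "3 * j \<le> L"
  shows "2 * norm ((F d ^^ j) 0) \<le>
    q d ^ j * norm ((F d ^^ (2 * j)) 0) + real j * (8 * K ^ 2 * R ^ 3 * d ^ 2)"
proof -
  let ?x = "(F d ^^ j) 0" and ?y = "(F d ^^ (2 * j)) 0" and ?G = "F (- d)"
  have y: "?y = (F d ^^ j) ?x" by (simp add: mult_2 funpow_add)
  have xl: "?x \<in> level d j" using funpow_level[OF zero_in_level, of 0 j d] j by simp
  have yl: "?y \<in> level d (2 * j)" using funpow_level[OF zero_in_level, of 0 "2 * j" d] j by simp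
  have "2 * norm ?x = norm (?x - (?G ^^ j) 0)"
    by (simp add: funpow_F_minus flip: scaleR_2)
  also have "\<dots> \<le> norm ((?G ^^ j) ?y - (?G ^^ j) 0) + norm ((?G ^^ j) ?y - ?x)"
    using norm_triangle_ineq4[of "(?G ^^ j) ?y - (?G ^^ j) 0" "(?G ^^ j) ?y - ?x"] by simp
  also have "\<dots> \<le> q d ^ j * norm (?y - 0) + real j * (8 * K ^ 2 * R ^ 3 * d ^ 2)"
    unfolding y using funpow_almost_inverse[OF xl] j
    by (intro add_mono funpow_lipschitz[OF yl[unfolded y] zero_in_level]) auto
  finally show ?thesis by simp
qed

text \<open>The quantity \<open>a i\<close> is the mean displacement per step over the first 2^i
  steps from 0. Doubling the time hardly lowers it, while boundedness of the orbit makes it small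
  for large times; its value after one step is the size of the field at 0.\<close>

lemma norm_field_le:
  assumes L: "2 * 2 ^ m \<le> L"
  shows "\<bar>d\<bar> * norm w \<le> 2 * R / 2 ^ m + real m * (8 * K ^ 2 * R ^ 3 * d ^ 2)"
proof -
  let ?c = "8 * K ^ 2 * R ^ 3 * d ^ 2"
  have c: "?c \<ge> 0" using R_nonneg by simp
  define a where "a i = norm ((F d ^^ (2 ^ i)) 0) / 2 ^ i" for i
  have B0: "B 0 0 = 0" using B_add[of 0 0 0] by simp
  have "\<bar>d\<bar> * norm w = a 0" by (simp add: a_def F_def B0)
  have step: "a i \<le> q d ^ (2 ^ i) * a (Suc i) + ?c / 2" if "i < m" for i
  proof -
    have "2 ^ i \<le> (2::nat) ^ m" using that by (simp add: power_increasing)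
    moreover have "2 * 2 ^ i \<le> (2::nat) ^ m"
      using that power_increasing[of "Suc i" m "2::nat"] by simp
    ultimately have "3 * 2 ^ i \<le> L" using L by linarith
    from norm_orbit_double[OF this]
    have "2 * norm ((F d ^^ (2 ^ i)) 0) \<le>
      q d ^ (2 ^ i) * norm ((F d ^^ (2 * 2 ^ i)) 0) + 2 ^ i * ?c" by simp
    then have "2 * norm ((F d ^^ (2 ^ i)) 0) / (2 * 2 ^ i) \<le>
      (q d ^ (2 ^ i) * norm ((F d ^^ (2 * 2 ^ i)) 0) + 2 ^ i * ?c) / (2 * 2 ^ i)"
      by (intro divide_right_mono) auto
    then show ?thesis by (simp add: a_def add_divide_distrib)
  qed
  \<comment> \<open>The exponent is 1 + 2 + ... + 2^(i - 1); as this power is at most 2, each error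
    \<open>?c / 2\<close> contributes at most \<open>?c\<close>.\<close>
  have "a 0 \<le> q d ^ (2 ^ i - 1) * a i + real i * ?c" if "i \<le> m" for i
    using that
  proof (induction i)
    case (Suc i)
    have le: "2 ^ i - 1 \<le> L"
      using L Suc.prems power_increasing[of i m "2::nat"] by linarith
    have "q d ^ (2 ^ i - 1) * a i \<le> q d ^ (2 ^ i - 1) * (q d ^ (2 ^ i) * a (Suc i) + ?c / 2)"
      using step[of i] Suc.prems q_ge_1[of d] by (intro mult_left_mono) auto
    also have "\<dots> = q d ^ (2 ^ Suc i - 1) * a (Suc i) + q d ^ (2 ^ i - 1) * (?c / 2)"
      by (simp add: distrib_left mult_2 flip: power_add mult.assoc)
    also have "q d ^ (2 ^ i - 1) * (?c / 2) \<le> 2 * (?c / 2)"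
      using q_power_le[OF le] c by (intro mult_right_mono) auto
    finally show ?case using Suc by (simp add: algebra_simps)
  qed simp
  then have "a 0 \<le> q d ^ (2 ^ m - 1) * a m + real m * ?c" by blast
  also have "q d ^ (2 ^ m - 1) * a m \<le> 2 * (R / 2 ^ m)"
  proof (intro mult_mono)
    show "q d ^ (2 ^ m - 1) \<le> 2" using L by (intro q_power_le) linarith
    have "(F d ^^ (2 ^ m)) 0 \<in> level d (2 ^ m)"
      using funpow_level[OF zero_in_level, of 0 "2 ^ m" d] L by simp
    then show "a m \<le> R / 2 ^ m"
      using level_norm_le L by (auto simp: a_def intro!: divide_right_mono)
  qed (auto simp: a_def)
  finally show ?thesis using \<open>\<bar>d\<bar> * norm w = a 0\<close> by simp
qed

end

lemma field_eq_zero: "w = 0"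
proof -
  define C where "C = 4 * K * R ^ 2"
  define c where "c = 8 * K ^ 2 * R ^ 3"
  have C: "C \<ge> 0" "c \<ge> 0" using K_nonneg R_nonneg by (simp_all add: C_def c_def)
  have "(\<lambda>p. C * 2 * (1 / 2) ^ p) \<longlonglongrightarrow> C * 2 * 0"
    by (intro tendsto_intros LIMSEQ_power_zero) auto
  then have "\<forall>\<^sub>F p in sequentially. C * 2 * (1 / 2) ^ p < ln 2"
    by (rule order_tendstoD) simp
  moreover have "norm w \<le> (2 * R + 3 * c) * (1 / 2) ^ p" if p: "C * 2 * (1 / 2) ^ p < ln 2" for p
  proof -
    \<comment> \<open>For N = 2^m steps of size d, the bounds require N d^2 and m d to tend to 0 and
      N d to tend to infinity; d = 4^(-p) and N = 8^p achieve all three.\<close>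
    define d :: real where "d = 1 / 4 ^ p"
    define m where "m = 3 * p"
    have d: "d > 0" by (simp add: d_def)
    have m: "(2::real) ^ m = 2 ^ p * 4 ^ p"
      by (simp add: m_def power_mult flip: power_mult_distrib)
    have dd: "d ^ 2 * 2 ^ m = (1 / 2) ^ p"
    proof -
      have "(4::real) ^ p = 2 ^ p * 2 ^ p" by (simp flip: power_mult_distrib)
      then show ?thesis by (simp add: d_def m power2_eq_square power_one_over)
    qed
    have "q d ^ (2 * 2 ^ m) \<le> exp (C * d ^ 2) ^ (2 * 2 ^ m)"
      using C by (intro power_mono) (auto simp: q_def C_def)
    also have "\<dots> = exp (C * 2 * (d ^ 2 * 2 ^ m))"
      by (simp flip: exp_of_nat_mult add: algebra_simps)
    also have "\<dots> \<le> exp (ln 2)" unfolding dd exp_le_cancel_iff using p by simp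
    finally have "q d ^ (2 * 2 ^ m) \<le> 2" by simp
    from norm_field_le[OF this, of m]
    have "d * norm w \<le> 2 * R / 2 ^ m + real m * (c * d ^ 2)" using d by (simp add: c_def)
    then have "norm w \<le> (2 * R / 2 ^ m + real m * (c * d ^ 2)) / d"
      using d by (simp add: pos_le_divide_eq mult.commute)
    also have "\<dots> = 2 * R * (1 / 2) ^ p + 3 * c * (real p * d)"
      using d by (simp add: add_divide_distrib power2_eq_square m_def[THEN arg_cong, of real])
        (simp add: m d_def power_one_over field_simps)
    also have "\<dots> \<le> 2 * R * (1 / 2) ^ p + 3 * c * (1 / 2) ^ p"
    proof (intro add_left_mono mult_left_mono)
      have "real p \<le> 2 ^ p" by (metis less_imp_le of_nat_less_two_power)
      then have "real p * d \<le> 2 ^ p * d" using d by (intro mult_right_mono) auto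
      also have "\<dots> = (1 / 2) ^ p"
      proof -
        have "(4::real) ^ p = 2 ^ p * 2 ^ p" by (simp flip: power_mult_distrib)
        then show ?thesis by (simp add: d_def power_one_over)
      qed
      finally show "real p * d \<le> (1 / 2) ^ p" .
    qed (use C in simp)
    finally show ?thesis by (simp add: algebra_simps)
  qed
  ultimately have "\<forall>\<^sub>F p in sequentially. norm w \<le> (2 * R + 3 * c) * (1 / 2) ^ p"
    by (rule eventually_mono)
  moreover have "(\<lambda>p. (2 * R + 3 * c) * (1 / 2) ^ p) \<longlonglongrightarrow> (2 * R + 3 * c) * 0"
    by (intro tendsto_intros LIMSEQ_power_zero) auto
  ultimately have "norm w \<le> (2 * R + 3 * c) * 0"
    by (intro tendsto_lowerbound) auto
  then show ?thesis by simp
qed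

end

lemma B_eq_zero:
  assumes "a \<in> E" "b \<in> E"
  shows "B a b = 0"
proof -
  have sq: "B u u = 0" if "u \<in> E" for u
    using field_eq_zero[OF that] w_def[OF that] by simp
  have "B (a + b) (a + b) = B a a + B a b + (B b a + B b b)"
    using assms B_add[of "a + b" a b] B_sym[of "a + b" a] B_sym[of "a + b" b]
      B_add[of a a b] B_add[of b a b] by simp
  then have "2 *\<^sub>R B a b = 0"
    using assms B_sym[of b a] by (simp add: sq scaleR_2)
  then show ?thesis by simp
qed

end

subsection \<open>Isometries between the cones preserve midpoints\<close>

lemma positive_invertibles_positive_cone: "x \<in> positive_invertibles \<Longrightarrow> x \<in> positive_cone"
proof -
  assume "x \<in> positive_invertibles"
  then obtain d where "d > 0" "x - d *\<^sub>R 1 \<in> positive_cone"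
    unfolding positive_invertibles_eq by blast
  then show ?thesis
    using positive_cone_add[of "x - d *\<^sub>R 1" "d *\<^sub>R 1"] by simp
qed

lemma positive_invertibles_self_adjoint: "x \<in> positive_invertibles \<Longrightarrow> x \<in> self_adjoint"
  by (rule positive_cone_self_adjoint[OF positive_invertibles_positive_cone])

lemma positive_invertiblesI: "x - d *\<^sub>R 1 \<in> positive_cone \<Longrightarrow> d > 0 \<Longrightarrow> x \<in> positive_invertibles"
  unfolding positive_invertibles_eq by blast

lemma positive_invertibles_plus_one:
  assumes "x \<in> positive_cone" "d > 0"
  shows "x + d *\<^sub>R 1 \<in> positive_invertibles"
  by (rule positive_invertiblesI[of _ d]) (use assms in auto)

lemma positive_invertibles_one: "d > 0 \<Longrightarrow> d *\<^sub>R 1 \<in> positive_invertibles"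
  using positive_invertibles_plus_one[OF positive_cone_zero] by simp

lemma positive_invertibles_shift:
  assumes "h \<in> self_adjoint" "norm h < d"
  shows "h + d *\<^sub>R 1 \<in> positive_invertibles"
proof (rule positive_invertiblesI)
  show "h + d *\<^sub>R 1 - (d - norm h) *\<^sub>R 1 \<in> positive_cone"
    using positive_cone_shift[OF assms(1) order_refl] by (simp add: algebra_simps)
qed (use assms in simp)

lemma positive_invertibles_ball:
  assumes x: "x - d *\<^sub>R 1 \<in> positive_cone" and u: "u \<in> self_adjoint" and d: "dist u x < d"
  shows "u \<in> positive_invertibles"
proof (rule positive_invertiblesI)
  have "u - x \<in> self_adjoint"
    using u positive_cone_self_adjoint[OF x] self_adjoint_add[of "x - d *\<^sub>R 1" "d *\<^sub>R 1"] by simp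
  then have "(x - d *\<^sub>R 1) + ((u - x) + norm (u - x) *\<^sub>R 1) \<in> positive_cone"
    by (intro positive_cone_add[OF x] positive_cone_shift order_refl)
  moreover have "(x - d *\<^sub>R 1) + ((u - x) + norm (u - x) *\<^sub>R 1) = u - (d - norm (u - x)) *\<^sub>R 1"
    by (simp add: algebra_simps)
  ultimately show "u - (d - norm (u - x)) *\<^sub>R 1 \<in> positive_cone"
    by (simp only:)
qed (use d in \<open>simp add: dist_norm\<close>)

lemma positive_invertibles_add:
  assumes "x \<in> positive_invertibles" "y \<in> positive_invertibles"
  shows "x + y \<in> positive_invertibles"
proof -
  obtain d where d: "d > 0" "x - d *\<^sub>R 1 \<in> positive_cone"
    using assms(1) unfolding positive_invertibles_eq by blast
  have "(x - d *\<^sub>R 1) + y \<in> positive_cone"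
    using d positive_invertibles_positive_cone[OF assms(2)] by simp
  then show ?thesis
    using d by (intro positive_invertiblesI[of _ d]) (simp_all add: algebra_simps)
qed

lemma positive_invertibles_scaleR:
  assumes "x \<in> positive_invertibles" "r > 0"
  shows "r *\<^sub>R x \<in> positive_invertibles"
proof -
  obtain d where d: "d > 0" "x - d *\<^sub>R 1 \<in> positive_cone"
    using assms(1) unfolding positive_invertibles_eq by blast
  have "r *\<^sub>R (x - d *\<^sub>R 1) \<in> positive_cone"
    using d assms by simp
  then show ?thesis
    using d assms by (intro positive_invertiblesI[of _ "r * d"]) (simp_all add: scaleR_diff_right)
qed

lemma positive_cone_LIMSEQ: "f \<longlonglongrightarrow> l \<Longrightarrow> (\<And>n. f n \<in> positive_cone) \<Longrightarrow> l \<in> positive_cone"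
  by (rule closed_sequentially[OF closed_positive_cone])

lemma positive_cone_limit:
  assumes "x \<in> self_adjoint" "\<And>d. d > 0 \<Longrightarrow> x + d *\<^sub>R 1 \<in> positive_cone"
  shows "x \<in> positive_cone"
proof -
  have "(\<lambda>n. x + inverse (real (Suc n)) *\<^sub>R 1) \<longlonglongrightarrow> x + 0 *\<^sub>R 1"
    by (intro tendsto_intros LIMSEQ_inverse_real_of_nat)
  moreover have "x + inverse (real (Suc n)) *\<^sub>R 1 \<in> positive_cone" for n
    by (rule assms(2)) simp
  ultimately have "x + 0 *\<^sub>R 1 \<in> positive_cone"
    by (rule positive_cone_LIMSEQ)
  then show ?thesis by simp
qed

lemma lens_symmetric:
  fixes a b u :: "'a::unital_jb_star_algebra"
  assumes "u \<in> {u \<in> self_adjoint. dist u a \<le> s \<and> dist u b \<le> s}" "a \<in> self_adjoint" "b \<in> self_adjoint"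
  shows "2 *\<^sub>R ((1/2) *\<^sub>R (a + b)) - u \<in> {u \<in> self_adjoint. dist u a \<le> s \<and> dist u b \<le> s}"
proof -
  have "dist (a + b - u) a = dist u b" "dist (a + b - u) b = dist u a"
    by (simp_all add: dist_norm norm_minus_commute)
  then show ?thesis using assms by simp
qed

lemma midpoint_in_lens:
  fixes a b :: "'a::unital_jb_star_algebra"
  assumes "a \<in> self_adjoint" "b \<in> self_adjoint"
  shows "(1/2) *\<^sub>R (a + b) \<in> {u \<in> self_adjoint. dist u a \<le> dist a b / 2 \<and> dist u b \<le> dist a b / 2}"
proof -
  have "(1/2) *\<^sub>R (a + b) - (1/2 + 1/2) *\<^sub>R a = (1/2) *\<^sub>R (b - a)"
    "(1/2) *\<^sub>R (a + b) - (1/2 + 1/2) *\<^sub>R b = (1/2) *\<^sub>R (a - b)"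
    unfolding scaleR_add_left by (simp_all add: scaleR_add_right scaleR_diff_right)
  then have "(1/2) *\<^sub>R (a + b) - a = (1/2) *\<^sub>R (b - a)" "(1/2) *\<^sub>R (a + b) - b = (1/2) *\<^sub>R (a - b)"
    by simp_all
  then show ?thesis using assms by (simp add: dist_norm norm_minus_commute)
qed

locale cone_isometry =
  fixes \<Delta> :: "'m::unital_jb_star_algebra \<Rightarrow> 'n::unital_jb_star_algebra"
  assumes surj: "\<Delta> ` positive_invertibles = positive_invertibles"
    and isometry: "\<And>a b. a \<in> positive_invertibles \<Longrightarrow> b \<in> positive_invertibles \<Longrightarrow>
                     dist (\<Delta> a) (\<Delta> b) = dist a b"
begin

lemma image_in: "x \<in> positive_invertibles \<Longrightarrow> \<Delta> x \<in> positive_invertibles"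
  using surj by blast

lemma image_self_adjoint: "x \<in> positive_invertibles \<Longrightarrow> \<Delta> x \<in> self_adjoint"
  by (simp add: image_in positive_invertibles_self_adjoint)

lemma ex_preimage:
  assumes "v \<in> positive_invertibles"
  obtains u where "u \<in> positive_invertibles" "\<Delta> u = v"
  using assms surj by (metis imageE)

lemma tendsto_image:
  assumes "\<And>n. u n \<in> positive_invertibles" "p \<in> positive_invertibles" "u \<longlonglongrightarrow> p"
  shows "(\<lambda>n. \<Delta> (u n)) \<longlonglongrightarrow> \<Delta> p"
proof -
  have "(\<lambda>n. dist (u n) p) \<longlonglongrightarrow> 0"
    by (rule iffD1[OF tendsto_dist_iff assms(3)])
  then have "(\<lambda>n. dist (\<Delta> (u n)) (\<Delta> p)) \<longlonglongrightarrow> 0"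
    by (simp only: isometry[OF assms(1,2)])
  then show ?thesis by (rule iffD2[OF tendsto_dist_iff])
qed

text \<open>The parameters for which the segment from \<open>\<Delta> x\<close> to \<open>v\<close> stays in the cone form a closed set,
  since the preimages of these points stay in a ball around \<open>x\<close> that is complete and contained in
  the cone.\<close>

lemma image_ball:
  assumes x: "x - d *\<^sub>R 1 \<in> positive_cone" and r: "r < d" and r0: "0 \<le> r"
    and v: "v \<in> self_adjoint" and vr: "dist v (\<Delta> x) \<le> r"
  shows "v \<in> positive_invertibles"
proof -
  have xi: "x \<in> positive_invertibles"
    using x r r0 by (intro positive_invertiblesI[of _ d]) auto
  define \<gamma> where "\<gamma> t = \<Delta> x + t *\<^sub>R (v - \<Delta> x)" for t :: real
  define S where "S = {t \<in> {0..1}. \<gamma> t \<in> positive_invertibles}"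
  have \<gamma>sa: "\<gamma> t \<in> self_adjoint" for t
    using v image_self_adjoint[OF xi] by (simp add: \<gamma>_def)
  have \<gamma>d: "dist (\<gamma> s) (\<gamma> t) = \<bar>s - t\<bar> * norm (v - \<Delta> x)" for s t
  proof -
    have "\<gamma> s - \<gamma> t = (s - t) *\<^sub>R (v - \<Delta> x)" by (simp add: \<gamma>_def algebra_simps)
    then show ?thesis by (simp add: dist_norm)
  qed
  have \<gamma>0: "\<gamma> 0 = \<Delta> x" by (simp add: \<gamma>_def)
  have op: "openin (top_of_set {0..1}) S"
    unfolding openin_euclidean_subtopology_iff
  proof (intro conjI ballI)
    fix t assume t: "t \<in> S"
    then obtain e where e: "e > 0" "\<gamma> t - e *\<^sub>R 1 \<in> positive_cone"
      unfolding S_def positive_invertibles_eq by blast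
    define k where "k = e / (norm (v - \<Delta> x) + 1)"
    have k: "k > 0" using e by (simp add: k_def add_nonneg_pos)
    have "s \<in> S" if s: "s \<in> {0..1}" "dist s t < k" for s
    proof -
      have "dist (\<gamma> s) (\<gamma> t) \<le> \<bar>s - t\<bar> * (norm (v - \<Delta> x) + 1)"
        by (simp add: \<gamma>d mult_left_mono)
      also have "\<dots> < k * (norm (v - \<Delta> x) + 1)"
        using s by (intro mult_strict_right_mono) (auto simp: dist_norm add_nonneg_pos)
      also have "\<dots> = e"
        using norm_ge_zero[of "v - \<Delta> x"] by (simp add: k_def add_nonneg_eq_0_iff)
      finally show ?thesis
        using positive_invertibles_ball[OF e(2) \<gamma>sa] s by (simp add: S_def)
    qed
    then show "\<exists>k>0. \<forall>s\<in>{0..1}. dist s t < k \<longrightarrow> s \<in> S" using k by blast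
  qed (auto simp: S_def)
  have "closed S"
    unfolding closed_sequential_limits
  proof (intro allI impI)
    fix t l assume t: "(\<forall>n. t n \<in> S) \<and> t \<longlonglongrightarrow> l"
    then have l01: "l \<in> {0..1}"
      using closed_sequentially[of "{0..1::real}" t l] by (auto simp: S_def)
    have "\<gamma> (t n) \<in> \<Delta> ` positive_invertibles" for n
      unfolding surj using t by (simp add: S_def)
    then have "\<exists>u. \<forall>n. u n \<in> positive_invertibles \<and> \<gamma> (t n) = \<Delta> (u n)"
      by (intro choice) blast
    then obtain u where u: "\<And>n. u n \<in> positive_invertibles" "\<And>n. \<Delta> (u n) = \<gamma> (t n)"
      by metis
    have \<gamma>l: "(\<lambda>n. \<gamma> (t n)) \<longlonglongrightarrow> \<gamma> l"
      unfolding \<gamma>_def using t by (intro tendsto_intros) auto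
    then have "Cauchy (\<lambda>n. \<gamma> (t n))" by (rule LIMSEQ_imp_Cauchy)
    moreover have "dist (\<gamma> (t m)) (\<gamma> (t n)) = dist (u m) (u n)" for m n
      using isometry[OF u(1) u(1), of m n] by (simp add: u(2))
    ultimately have "Cauchy u"
      unfolding Cauchy_def by simp
    then obtain p where p: "u \<longlonglongrightarrow> p" using Cauchy_convergent convergentD by blast
    have "dist (u n) x \<le> r" for n
    proof -
      have "dist (u n) x = dist (\<gamma> (t n)) (\<gamma> 0)" using isometry[OF u(1) xi] u(2) \<gamma>0 by simp
      also have "\<dots> \<le> 1 * norm (v - \<Delta> x)"
        unfolding \<gamma>d using t by (intro mult_right_mono) (auto simp: S_def)
      finally show ?thesis using vr by (simp add: dist_norm)
    qed
    then have "dist p x \<le> r"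
      by (intro LIMSEQ_le_const2[OF tendsto_dist[OF p tendsto_const]]) auto
    moreover have "p \<in> self_adjoint"
      using closed_sequentially[OF closed_self_adjoint positive_invertibles_self_adjoint[OF u(1)] p] .
    ultimately have pi: "p \<in> positive_invertibles"
      using positive_invertibles_ball[OF x] r by simp
    have "(\<lambda>n. \<Delta> (u n)) \<longlonglongrightarrow> \<Delta> p" using u(1) pi p by (rule tendsto_image)
    then have "\<gamma> l = \<Delta> p" unfolding u(2) by (rule LIMSEQ_unique[OF \<gamma>l])
    then show "l \<in> S" using l01 image_in[OF pi] by (simp add: S_def)
  qed
  then have "closedin (top_of_set {0..1}) S"
    by (intro closed_subset) (auto simp: S_def)
  with op have "S = {} \<or> S = {0..1}"
    using connected_Icc[of 0 "1::real"] unfolding connected_clopen by blast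
  moreover have "0 \<in> S" using image_in[OF xi] by (simp add: S_def \<gamma>0)
  ultimately have "S = {0..1}" by blast
  then have "1 \<in> S" by simp
  then have "\<gamma> 1 \<in> positive_invertibles" by (simp add: S_def)
  then show ?thesis by (simp add: \<gamma>_def)
qed

lemma half_sum_in:
  assumes "x - d *\<^sub>R 1 \<in> positive_cone" "y - d *\<^sub>R 1 \<in> positive_cone"
  shows "(1/2) *\<^sub>R (x + y) - d *\<^sub>R 1 \<in> positive_cone"
proof -
  have "(1/2) *\<^sub>R ((x - d *\<^sub>R 1) + (y - d *\<^sub>R 1)) \<in> positive_cone"
    using assms by simp
  moreover have "(1/2) *\<^sub>R ((x - d *\<^sub>R 1) + (y - d *\<^sub>R 1)) = (1/2) *\<^sub>R (x + y) - d *\<^sub>R 1"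
    by (simp add: algebra_simps flip: scaleR_add_left)
  ultimately show ?thesis by simp
qed

text \<open>The lens of metric midpoints lies within distance r < d of \<open>x\<close>, hence in
  the cone. By \<open>image_ball\<close> the lens of the images also lies in the cone, so
  surjectivity makes it the full image of the first lens.\<close>

lemma midpoint_near:
  assumes x: "x - d *\<^sub>R 1 \<in> positive_cone" and y: "y - d *\<^sub>R 1 \<in> positive_cone"
    and d: "d > 0" and xy: "dist x y \<le> d"
  shows "\<Delta> ((1/2) *\<^sub>R (x + y)) = (1/2) *\<^sub>R (\<Delta> x + \<Delta> y)"
proof -
  define r where "r = dist x y / 2"
  have r: "0 \<le> r" "r < d" using xy d by (auto simp: r_def)
  have xi: "x \<in> positive_invertibles" and yi: "y \<in> positive_invertibles"
    using x y d positive_invertiblesI by blast+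
  define A where "A = {u \<in> self_adjoint. dist u x \<le> r \<and> dist u y \<le> r}"
  define A' where "A' = {u \<in> self_adjoint. dist u (\<Delta> x) \<le> r \<and> dist u (\<Delta> y) \<le> r}"
  have A_in: "u \<in> positive_invertibles" if "u \<in> A" for u
    using that positive_invertibles_ball[OF x] r by (auto simp: A_def)
  have image: "\<Delta> ` A = A'"
  proof (intro set_eqI iffI)
    fix v assume "v \<in> \<Delta> ` A"
    then obtain u where u: "u \<in> A" "v = \<Delta> u" by blast
    then show "v \<in> A'"
      using A_in[OF u(1)] isometry xi yi image_self_adjoint by (simp add: A_def A'_def)
  next
    fix v assume v: "v \<in> A'"
    then have "v \<in> positive_invertibles"
      using image_ball[OF x r(2,1)] by (auto simp: A'_def)
    then obtain u where u: "u \<in> positive_invertibles" "\<Delta> u = v" by (rule ex_preimage)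
    then have "u \<in> A"
      using v isometry[OF u(1) xi] isometry[OF u(1) yi] positive_invertibles_self_adjoint[OF u(1)]
      by (simp add: A_def A'_def)
    then show "v \<in> \<Delta> ` A" using u by blast
  qed
  have sa: "x \<in> self_adjoint" "y \<in> self_adjoint" "\<Delta> x \<in> self_adjoint" "\<Delta> y \<in> self_adjoint"
    using xi yi positive_invertibles_self_adjoint image_in by blast+
  show ?thesis
  proof (rule isometry_center[where A=A and D="2 * r"])
    show "dist (\<Delta> u) (\<Delta> v) = dist u v" if "u \<in> A" "v \<in> A" for u v
      using that A_in isometry by blast
    show "2 *\<^sub>R ((1/2) *\<^sub>R (x + y)) - u \<in> A" if "u \<in> A" for u
      using lens_symmetric[of u x r y] that sa unfolding A_def by blast
    show "(1/2) *\<^sub>R (x + y) \<in> A"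
      using midpoint_in_lens[OF sa(1,2)] unfolding A_def r_def .
    show "dist u v \<le> 2 * r" if "u \<in> A" "v \<in> A" for u v
      using that dist_triangle2[of u v x] by (auto simp: A_def)
    show "2 *\<^sub>R ((1/2) *\<^sub>R (\<Delta> x + \<Delta> y)) - u \<in> \<Delta> ` A" if "u \<in> \<Delta> ` A" for u
      using lens_symmetric[of u "\<Delta> x" r "\<Delta> y"] that sa unfolding image A'_def by blast
    show "(1/2) *\<^sub>R (\<Delta> x + \<Delta> y) \<in> \<Delta> ` A"
      using midpoint_in_lens[OF sa(3,4)] unfolding image A'_def r_def isometry[OF xi yi] .
  qed
qed

text \<open>With quarter points \<open>a\<close> and \<open>b\<close>, the pairs x, m and m, y and
  a, b have half the original distance, and \<open>m\<close> is also the midpoint of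
  \<open>a\<close> and \<open>b\<close>. The three induction hypotheses give a linear equation for
  the image of \<open>m\<close>.\<close>

lemma midpoint_dyadic:
  assumes "x - d *\<^sub>R 1 \<in> positive_cone" "y - d *\<^sub>R 1 \<in> positive_cone"
    and d: "d > 0" and "dist x y \<le> 2 ^ k * d"
  shows "\<Delta> ((1/2) *\<^sub>R (x + y)) = (1/2) *\<^sub>R (\<Delta> x + \<Delta> y)"
  using assms(1,2,4)
proof (induction k arbitrary: x y)
  case 0
  then show ?case using midpoint_near d by simp
next
  case (Suc k)
  define m where "m = (1/2) *\<^sub>R (x + y)"
  define a where "a = (1/2) *\<^sub>R (x + m)"
  define b where "b = (1/2) *\<^sub>R (m + y)"
  have m: "m - d *\<^sub>R 1 \<in> positive_cone"
    unfolding m_def by (rule half_sum_in) (use Suc in auto)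
  have a: "a - d *\<^sub>R 1 \<in> positive_cone" and b: "b - d *\<^sub>R 1 \<in> positive_cone"
    unfolding a_def b_def using half_sum_in m Suc.prems by blast+
  have half: "x - m = (1/2) *\<^sub>R (x - y)" "m - y = (1/2) *\<^sub>R (x - y)" "a - b = (1/2) *\<^sub>R (x - y)"
  proof -
    have 2: "x = (1/2) *\<^sub>R x + (1/2) *\<^sub>R x" "y = (1/2) *\<^sub>R y + (1/2) *\<^sub>R y"
      by (simp_all flip: scaleR_add_left)
    show "x - m = (1/2) *\<^sub>R (x - y)" by (subst 2(1)) (simp add: m_def algebra_simps)
    show "m - y = (1/2) *\<^sub>R (x - y)" by (subst 2(2)) (simp add: m_def algebra_simps)
    show "a - b = (1/2) *\<^sub>R (x - y)" by (simp add: a_def b_def algebra_simps)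
  qed
  have dist: "dist x m \<le> 2 ^ k * d" "dist m y \<le> 2 ^ k * d" "dist a b \<le> 2 ^ k * d"
    using Suc.prems by (simp_all add: dist_norm half)
  have ab: "(1/2) *\<^sub>R (a + b) = m"
  proof -
    have "a + b = (1/2) *\<^sub>R (x + y) + m"
      unfolding a_def b_def by (simp add: algebra_simps flip: scaleR_add_left)
    then show ?thesis by (simp add: m_def flip: scaleR_2)
  qed
  have "\<Delta> m = (1/2) *\<^sub>R (\<Delta> a + \<Delta> b)"
    using Suc.IH[OF a b dist(3)] unfolding ab .
  also have "\<Delta> a = (1/2) *\<^sub>R (\<Delta> x + \<Delta> m)"
    unfolding a_def using Suc.IH Suc.prems m dist by blast
  also have "\<Delta> b = (1/2) *\<^sub>R (\<Delta> m + \<Delta> y)"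
    unfolding b_def using Suc.IH Suc.prems m dist by blast
  finally have "2 *\<^sub>R \<Delta> m = 2 *\<^sub>R ((1/2) *\<^sub>R ((1/2) *\<^sub>R (\<Delta> x + \<Delta> m) + (1/2) *\<^sub>R (\<Delta> m + \<Delta> y)))"
    by (rule arg_cong)
  also have "\<dots> = (1/2) *\<^sub>R (\<Delta> x + \<Delta> m) + (1/2) *\<^sub>R (\<Delta> m + \<Delta> y)"
    by (simp only: scaleR_scaleR) simp
  also have "\<dots> = (1/2) *\<^sub>R (\<Delta> x + \<Delta> y) + \<Delta> m"
    by (simp add: algebra_simps flip: scaleR_add_left)
  finally show ?case by (simp add: scaleR_2 flip: m_def)
qed

lemma midpoint:
  assumes "x \<in> positive_invertibles" "y \<in> positive_invertibles"
  shows "\<Delta> ((1/2) *\<^sub>R (x + y)) = (1/2) *\<^sub>R (\<Delta> x + \<Delta> y)"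
proof -
  obtain d e where d: "d > 0" "x - d *\<^sub>R 1 \<in> positive_cone" and e: "e > 0" "y - e *\<^sub>R 1 \<in> positive_cone"
    using assms unfolding positive_invertibles_eq by blast
  define m where "m = min d e"
  have m: "m > 0" using d e by (simp add: m_def)
  have "(x - d *\<^sub>R 1) + (d - m) *\<^sub>R 1 \<in> positive_cone" "(y - e *\<^sub>R 1) + (e - m) *\<^sub>R 1 \<in> positive_cone"
    using d e by (auto simp: m_def intro!: positive_cone_add positive_cone_one)
  then have "x - m *\<^sub>R 1 \<in> positive_cone" "y - m *\<^sub>R 1 \<in> positive_cone"
    by (simp_all add: algebra_simps)
  moreover obtain k where "dist x y / m < 2 ^ k"
    using real_arch_pow[of 2 "dist x y / m"] by auto
  then have "dist x y \<le> 2 ^ k * m" using m by (simp add: field_simps)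
  ultimately show ?thesis using midpoint_dyadic m by blast
qed

text \<open>By continuity \<open>\<Delta>\<close> has a value \<open>c\<close> at the vertex of the cone, and \<open>0 \<le> c \<le> (2 / n) 1\<close>.\<close>

lemma image_half:
  assumes x: "x \<in> positive_invertibles"
  shows "\<Delta> ((1/2) *\<^sub>R x) = (1/2) *\<^sub>R \<Delta> x"
proof -
  define e where "e n = inverse (real (Suc n)) *\<^sub>R (1::'m)" for n
  have e: "e n \<in> positive_invertibles" for n
    by (simp add: e_def positive_invertibles_one)
  have e0: "e \<longlonglongrightarrow> 0 *\<^sub>R 1"
    unfolding e_def by (intro tendsto_intros LIMSEQ_inverse_real_of_nat)
  then have "Cauchy e" by (rule LIMSEQ_imp_Cauchy)
  then have "Cauchy (\<lambda>n. \<Delta> (e n))"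
    unfolding Cauchy_def by (metis e isometry)
  then obtain c where c: "(\<lambda>n. \<Delta> (e n)) \<longlonglongrightarrow> c"
    using Cauchy_convergent convergentD by blast
  have cpos: "c \<in> positive_cone"
    using positive_cone_LIMSEQ[OF c] positive_invertibles_positive_cone[OF image_in[OF e]] .
  have half: "\<Delta> ((1/2) *\<^sub>R y) = (1/2) *\<^sub>R (\<Delta> y + c)" if y: "y \<in> positive_invertibles" for y
  proof -
    have "(\<lambda>n. (1/2) *\<^sub>R (y + e n)) \<longlonglongrightarrow> (1/2) *\<^sub>R (y + 0 *\<^sub>R 1)"
      by (intro tendsto_intros e0)
    then have "(\<lambda>n. \<Delta> ((1/2) *\<^sub>R (y + e n))) \<longlonglongrightarrow> \<Delta> ((1/2) *\<^sub>R y)"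
      using y e by (intro tendsto_image positive_invertibles_scaleR positive_invertibles_add) auto
    moreover have "(\<lambda>n. \<Delta> ((1/2) *\<^sub>R (y + e n))) \<longlonglongrightarrow> (1/2) *\<^sub>R (\<Delta> y + c)"
      unfolding midpoint[OF y e] by (intro tendsto_intros c)
    ultimately show ?thesis using LIMSEQ_unique by blast
  qed
  have "norm c \<le> 2 * inverse (real (Suc n))" for n
  proof -
    let ?r = "inverse (real (Suc n))"
    \<comment> \<open>Surjectivity supplies a preimage of r 1; the image of its double is 2 r 1 - c,
      which is positive.\<close>
    obtain u where u: "u \<in> positive_invertibles" "\<Delta> u = ?r *\<^sub>R 1"
      using ex_preimage[OF positive_invertibles_one[of ?r]] by auto
    have u2: "2 *\<^sub>R u \<in> positive_invertibles" using u by (simp add: positive_invertibles_scaleR)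
    have "?r *\<^sub>R 1 = (1/2) *\<^sub>R (\<Delta> (2 *\<^sub>R u) + c)" using half[OF u2] u by simp
    then have "2 *\<^sub>R (?r *\<^sub>R 1) = \<Delta> (2 *\<^sub>R u) + c" by simp
    then have "(2 * ?r) *\<^sub>R 1 - c = \<Delta> (2 *\<^sub>R u)" by simp
    then have 1: "(2 * ?r) *\<^sub>R 1 - c \<in> positive_cone"
      using positive_invertibles_positive_cone[OF image_in[OF u2]] by simp
    have 2: "(2 * ?r) *\<^sub>R 1 + c \<in> positive_cone"
      using cpos by (intro positive_cone_add positive_cone_one) auto
    show ?thesis by (rule norm_leI[OF 1 2]) simp
  qed
  moreover have "(\<lambda>n. 2 * inverse (real (Suc n))) \<longlonglongrightarrow> 2 * 0"
    by (intro tendsto_intros LIMSEQ_inverse_real_of_nat)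
  ultimately have "norm c \<le> 2 * 0" by (rule LIMSEQ_le_const[rotated, OF exI, OF allI, OF impI])
  then show ?thesis using half[OF x] by simp
qed

lemma image_add:
  assumes "x \<in> positive_invertibles" "y \<in> positive_invertibles"
  shows "\<Delta> (x + y) = \<Delta> x + \<Delta> y"
proof -
  have 2: "2 *\<^sub>R x \<in> positive_invertibles" "2 *\<^sub>R y \<in> positive_invertibles"
    using assms by (simp_all add: positive_invertibles_scaleR)
  have half: "\<Delta> z = (1/2) *\<^sub>R \<Delta> (2 *\<^sub>R z)" if "2 *\<^sub>R z \<in> positive_invertibles" for z
    using image_half[OF that] by (simp only: scaleR_scaleR) simp
  have "x + y = (1/2) *\<^sub>R (2 *\<^sub>R x + 2 *\<^sub>R y)"
    by (simp add: scaleR_add_right)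
  then have "\<Delta> (x + y) = \<Delta> ((1/2) *\<^sub>R (2 *\<^sub>R x + 2 *\<^sub>R y))"
    by (rule arg_cong)
  also have "\<dots> = (1/2) *\<^sub>R (\<Delta> (2 *\<^sub>R x) + \<Delta> (2 *\<^sub>R y))"
    by (rule midpoint[OF 2])
  also have "\<dots> = \<Delta> x + \<Delta> y"
    unfolding half[OF 2(1)] half[OF 2(2)] by (rule scaleR_add_right)
  finally show ?thesis .
qed

subsection \<open>The linear extension to the self-adjoint part\<close>

text \<open>The shift writes \<open>x\<close> as a difference of two points of the open cone;
  additivity makes the size of the shift irrelevant, see \<open>T_eq\<close>.\<close>

definition "T x = \<Delta> (x + (norm x + 1) *\<^sub>R 1) - \<Delta> ((norm x + 1) *\<^sub>R 1)"

lemma T_eq: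
  assumes x: "x \<in> self_adjoint" and k: "norm x < k"
  shows "T x = \<Delta> (x + k *\<^sub>R 1) - \<Delta> (k *\<^sub>R 1)"
proof -
  let ?l = "norm x + 1"
  have l: "?l > 0" "k > 0" using k norm_ge_zero[of x] by linarith+
  have "\<Delta> (x + ?l *\<^sub>R 1) + \<Delta> (k *\<^sub>R 1) = \<Delta> ((x + ?l *\<^sub>R 1) + k *\<^sub>R 1)"
    by (rule image_add[symmetric]) (use positive_invertibles_shift[OF x] positive_invertibles_one l in auto)
  also have "(x + ?l *\<^sub>R 1) + k *\<^sub>R 1 = (x + k *\<^sub>R 1) + ?l *\<^sub>R 1"
    by (simp only: add_ac)
  also have "\<Delta> \<dots> = \<Delta> (x + k *\<^sub>R 1) + \<Delta> (?l *\<^sub>R 1)"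
    by (rule image_add) (use positive_invertibles_shift[OF x k] positive_invertibles_one l in auto)
  finally show ?thesis
    unfolding T_def by (metis add_diff_cancel_right' add_diff_eq diff_add_eq)
qed

lemma T_eq_image:
  assumes x: "x \<in> positive_invertibles"
  shows "T x = \<Delta> x"
proof -
  have "norm x + 1 > 0" by (simp add: add_nonneg_pos)
  then show ?thesis using image_add[OF x positive_invertibles_one] by (simp add: T_def)
qed

lemma T_in: "x \<in> self_adjoint \<Longrightarrow> T x \<in> self_adjoint"
  unfolding T_def
  by (intro self_adjoint_diff image_self_adjoint positive_invertibles_shift positive_invertibles_one)
    (auto simp: add_nonneg_pos)

lemma T_add:
  assumes x: "x \<in> self_adjoint" and y: "y \<in> self_adjoint"
  shows "T (x + y) = T x + T y"
proof -
  define k where "k = norm x + norm y + 1"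
  have k: "norm x < k" "norm y < k" "norm (x + y) < k + k"
    using norm_triangle_ineq[of x y] norm_ge_zero[of x] norm_ge_zero[of y]
    unfolding k_def by linarith+
  have k0: "k > 0" using k(1) norm_ge_zero[of x] by linarith
  have "(x + y) + (k + k) *\<^sub>R 1 = (x + k *\<^sub>R 1) + (y + k *\<^sub>R 1)"
    by (simp only: scaleR_add_left add_ac)
  then have "\<Delta> ((x + y) + (k + k) *\<^sub>R 1) = \<Delta> (x + k *\<^sub>R 1) + \<Delta> (y + k *\<^sub>R 1)"
    using image_add[OF positive_invertibles_shift[OF x k(1)] positive_invertibles_shift[OF y k(2)]]
    by (rule trans[OF arg_cong])
  moreover have "\<Delta> ((k + k) *\<^sub>R 1) = \<Delta> (k *\<^sub>R 1) + \<Delta> (k *\<^sub>R 1)"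
    unfolding scaleR_add_left
    by (rule image_add[OF positive_invertibles_one[OF k0] positive_invertibles_one[OF k0]])
  ultimately show ?thesis
    using T_eq[OF x k(1)] T_eq[OF y k(2)] T_eq[OF self_adjoint_add[OF x y] k(3)] by simp
qed

lemma T_zero [simp]: "T 0 = 0"
  using T_add[of 0 0] by simp

lemma T_minus: "x \<in> self_adjoint \<Longrightarrow> T (- x) = - T x"
  using T_add[of x "- x"] by (simp add: eq_neg_iff_add_eq_0 add.commute)

lemma T_diff: "x \<in> self_adjoint \<Longrightarrow> y \<in> self_adjoint \<Longrightarrow> T (x - y) = T x - T y"
  using T_add[of x "- y"] T_minus[of y] by simp

lemma norm_T [simp]:
  assumes x: "x \<in> self_adjoint"
  shows "norm (T x) = norm x"
proof -
  have k: "norm x < norm x + 1" "0 < norm x + 1" by (simp_all add: add_nonneg_pos)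
  have "dist (\<Delta> (x + (norm x + 1) *\<^sub>R 1)) (\<Delta> ((norm x + 1) *\<^sub>R 1)) = norm x"
    using isometry[OF positive_invertibles_shift[OF x k(1)] positive_invertibles_one[OF k(2)]]
    by (simp add: dist_norm)
  then show ?thesis by (simp add: T_def dist_norm)
qed

lemma T_scaleR:
  assumes x: "x \<in> self_adjoint"
  shows "T (r *\<^sub>R x) = r *\<^sub>R T x"
proof -
  have "T (r *\<^sub>R x) = r *\<^sub>R T (1 *\<^sub>R x)"
  proof (rule additive_bounded_imp_linear[where K="norm x"])
    show "T ((s + t) *\<^sub>R x) = T (s *\<^sub>R x) + T (t *\<^sub>R x)" for s t
      using x by (simp add: scaleR_add_left T_add)
    show "norm (T (t *\<^sub>R x)) \<le> norm x * \<bar>t\<bar>" for t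
      using x by (simp add: mult.commute)
  qed
  then show ?thesis by simp
qed

lemma T_injective: "x \<in> self_adjoint \<Longrightarrow> y \<in> self_adjoint \<Longrightarrow> T x = T y \<Longrightarrow> x = y"
  using norm_T[of "x - y"] by (simp add: T_diff)

lemma ex_T_preimage:
  assumes y: "y \<in> self_adjoint"
  shows "\<exists>x\<in>self_adjoint. T x = y"
proof -
  define k where "k = norm y + 1"
  have k: "norm y < k" "k > 0" by (simp_all add: k_def add_nonneg_pos)
  obtain u where u: "u \<in> positive_invertibles" "\<Delta> u = y + k *\<^sub>R 1"
    using ex_preimage[OF positive_invertibles_shift[OF y k(1)]] by blast
  obtain v where v: "v \<in> positive_invertibles" "\<Delta> v = k *\<^sub>R 1"
    using ex_preimage[OF positive_invertibles_one[OF k(2)]] by blast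
  have "T (u - v) = y"
    using u v by (simp add: T_diff positive_invertibles_self_adjoint T_eq_image)
  moreover have "u - v \<in> self_adjoint"
    using u(1) v(1) by (intro self_adjoint_diff positive_invertibles_self_adjoint)
  ultimately show ?thesis by (rule bexI)
qed

lemma T_positive:
  assumes x: "x \<in> positive_cone"
  shows "T x \<in> positive_cone"
proof -
  have xs: "x \<in> self_adjoint" using x by (rule positive_cone_self_adjoint)
  have "(\<lambda>n. T x + inverse (real (Suc n)) *\<^sub>R T 1) \<longlonglongrightarrow> T x + 0 *\<^sub>R T 1"
    by (intro tendsto_intros LIMSEQ_inverse_real_of_nat)
  moreover have "T x + inverse (real (Suc n)) *\<^sub>R T 1 \<in> positive_cone" for n
  proof -
    have i: "x + inverse (real (Suc n)) *\<^sub>R 1 \<in> positive_invertibles"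
      using x by (intro positive_invertibles_plus_one) auto
    have "T x + inverse (real (Suc n)) *\<^sub>R T 1 = T (x + inverse (real (Suc n)) *\<^sub>R 1)"
      using xs by (simp add: T_add T_scaleR)
    also have "\<dots> \<in> positive_cone"
      using T_eq_image[OF i] positive_invertibles_positive_cone[OF image_in[OF i]] by simp
    finally show ?thesis .
  qed
  ultimately have "T x + 0 *\<^sub>R T 1 \<in> positive_cone"
    by (rule positive_cone_LIMSEQ)
  then show ?thesis by simp
qed

text \<open>The unit is the largest self-adjoint element of norm at most 1 in either algebra. Its
  preimage v satisfies v \<le> 1, so 1 \<le> T 1, and the norm of T 1 gives the converse.\<close>

lemma T_one [simp]: "T 1 = 1"
proof -
  obtain v where v: "v \<in> self_adjoint" "T v = 1"
    using ex_T_preimage[of 1] by auto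
  have "norm v \<le> 1" using norm_T[OF v(1)] v(2) norm_one_le[where 'a='n] by simp
  then have "T (1 - v) \<in> positive_cone"
    using positive_cone_shift'[OF v(1), of 1] by (intro T_positive) simp
  then have "T 1 - 1 \<in> positive_cone" using v by (simp add: T_diff)
  moreover have "norm (T 1) \<le> 1" using norm_one_le[where 'a='m] by simp
  then have "1 - T 1 \<in> positive_cone"
    using positive_cone_shift'[OF T_in[of 1], of 1] by simp
  ultimately show ?thesis
    using positive_cone_antisym[of "T 1 - 1"] by simp
qed

lemma T_positive_iff:
  assumes x: "x \<in> self_adjoint"
  shows "T x \<in> positive_cone \<longleftrightarrow> x \<in> positive_cone"
proof
  assume T: "T x \<in> positive_cone"
  show "x \<in> positive_cone"
  proof (rule positive_cone_limit[OF x])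
    fix d :: real assume d: "d > 0"
    obtain u where u: "u \<in> positive_invertibles" "\<Delta> u = T x + d *\<^sub>R 1"
      using ex_preimage[OF positive_invertibles_plus_one[OF T d]] by blast
    have "T (x + d *\<^sub>R 1) = T u"
      using x u by (simp add: T_add T_scaleR T_eq_image)
    then have "x + d *\<^sub>R 1 = u"
      using x u positive_invertibles_self_adjoint by (intro T_injective) auto
    then show "x + d *\<^sub>R 1 \<in> positive_cone"
      using u positive_invertibles_positive_cone by simp
  qed
qed (rule T_positive)

end

subsection \<open>The extension preserves Jordan products\<close>

lemma positive_cone_perturb:
  assumes x: "x \<in> positive_cone" "1 - x \<in> positive_cone" and f: "f \<in> self_adjoint"
  shows "x + (2 * e) *\<^sub>R (f \<circ>\<^sub>J x) + (e ^ 2 * norm f ^ 2) *\<^sub>R 1 \<in> positive_cone"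
proof -
  have xs: "x \<in> self_adjoint" using x by (simp add: positive_cone_self_adjoint)
  have "norm (f \<circ>\<^sub>J f) \<le> norm f ^ 2"
    using norm_jprod_le[of f f] by (simp add: power2_eq_square)
  then have "norm f ^ 2 *\<^sub>R 1 - f \<circ>\<^sub>J f \<in> positive_cone"
    using positive_cone_shift'[of "f \<circ>\<^sub>J f"] f by simp
  then have "(x - x \<circ>\<^sub>J x) + (x + e *\<^sub>R f) \<circ>\<^sub>J (x + e *\<^sub>R f) + e ^ 2 *\<^sub>R (norm f ^ 2 *\<^sub>R 1 - f \<circ>\<^sub>J f)
      \<in> positive_cone"
    using positive_cone_minus_square[OF x] xs f
    by (intro positive_cone_add square_in_positive_cone positive_cone_scaleR) auto
  also have "(x - x \<circ>\<^sub>J x) + (x + e *\<^sub>R f) \<circ>\<^sub>J (x + e *\<^sub>R f) + e ^ 2 *\<^sub>R (norm f ^ 2 *\<^sub>R 1 - f \<circ>\<^sub>J f)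
      = x + (2 * e) *\<^sub>R (f \<circ>\<^sub>J x) + (e ^ 2 * norm f ^ 2) *\<^sub>R 1"
    by (simp add: jprod.add_left jprod.add_right jprod.scaleR_left jprod.scaleR_right
        jprod_commute[of x f] scaleR_diff_right scaleR_add_right power2_eq_square scaleR_2 flip: scaleR_scaleR)
  finally show ?thesis .
qed

context cone_isometry
begin

definition "S = inv_into self_adjoint T"

lemma S_in [simp]: "y \<in> self_adjoint \<Longrightarrow> S y \<in> self_adjoint"
  and T_S [simp]: "y \<in> self_adjoint \<Longrightarrow> T (S y) = y"
  using ex_T_preimage[of y] by (auto simp: S_def intro: inv_into_into f_inv_into_f)

definition "B a b = a \<circ>\<^sub>J b - S (T a \<circ>\<^sub>J T b)"

lemma B_in: "a \<in> self_adjoint \<Longrightarrow> b \<in> self_adjoint \<Longrightarrow> B a b \<in> self_adjoint"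
  by (simp add: B_def T_in)

lemma T_B: "a \<in> self_adjoint \<Longrightarrow> b \<in> self_adjoint \<Longrightarrow> T (B a b) = T (a \<circ>\<^sub>J b) - T a \<circ>\<^sub>J T b"
  by (simp add: B_def T_in T_diff)

lemma B_add:
  assumes "a \<in> self_adjoint" "b \<in> self_adjoint" "c \<in> self_adjoint"
  shows "B a (b + c) = B a b + B a c"
proof (rule T_injective)
  show "T (B a (b + c)) = T (B a b + B a c)"
    using assms by (simp add: T_B B_in T_add jprod.add_right)
qed (use assms B_in in auto)

lemma B_scaleR:
  assumes "a \<in> self_adjoint" "b \<in> self_adjoint"
  shows "B a (r *\<^sub>R b) = r *\<^sub>R B a b"
proof (rule T_injective)
  show "T (B a (r *\<^sub>R b)) = T (r *\<^sub>R B a b)"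
    using assms by (simp add: T_B B_in T_scaleR jprod.scaleR_right scaleR_diff_right)
qed (use assms B_in in auto)

lemma B_one:
  assumes "a \<in> self_adjoint"
  shows "B a 1 = 0"
  using T_injective[of "B a 1" 0] assms B_in by (simp add: T_B)

text \<open>The multiplication operators of both products satisfy the bound of
  \<open>positive_cone_perturb\<close>, and their difference annihilates 1.\<close>

lemma B_positive:
  assumes f: "f \<in> self_adjoint" and b: "b \<in> self_adjoint" "norm b \<le> 1"
  shows "(1 + 2 * e ^ 2 * norm f ^ 2) *\<^sub>R 1 - (b + e *\<^sub>R B f b) \<in> positive_cone"
proof -
  \<comment> \<open>An affine map takes the unit ball to the order interval from 0 to 1; since
    \<open>B f\<close> annihilates 1, it changes \<open>B f\<close> only by a factor.\<close>
  define x where "x = (1/2) *\<^sub>R (1 - b)"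
  have "1 - x = (1/2) *\<^sub>R (1 + b)"
    using scaleR_half_double[of "1::'m"] unfolding x_def by (simp add: algebra_simps)
  moreover have "1 - b \<in> positive_cone" "1 + b \<in> positive_cone"
    using positive_cone_shift'[OF b] positive_cone_shift[OF b] by (simp_all add: add.commute)
  ultimately have x: "x \<in> positive_cone" "1 - x \<in> positive_cone"
    by (simp_all add: x_def)
  have xs: "x \<in> self_adjoint" using x by (simp add: positive_cone_self_adjoint)
  let ?c = "e ^ 2 * norm f ^ 2"
  have 1: "x + (2 * e) *\<^sub>R (f \<circ>\<^sub>J x) + ?c *\<^sub>R 1 \<in> positive_cone"
    by (rule positive_cone_perturb[OF x f])
  have "1 - T x \<in> positive_cone"
    using T_positive[OF x(2)] xs by (simp add: T_diff)
  \<comment> \<open>The opposite sign of \<open>e\<close> is used for the second product, so that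
    adding the two estimates produces the difference \<open>B\<close>.\<close>
  then have "T x + (2 * (- e)) *\<^sub>R (T f \<circ>\<^sub>J T x) + ((- e) ^ 2 * norm (T f) ^ 2) *\<^sub>R 1 \<in> positive_cone"
    by (rule positive_cone_perturb[OF T_positive[OF x(1)] _ T_in[OF f]])
  then have "T (x + (2 * (- e)) *\<^sub>R S (T f \<circ>\<^sub>J T x) + ?c *\<^sub>R 1) \<in> positive_cone"
    using f xs by (simp add: T_add T_diff T_scaleR T_in)
  then have 2: "x + (2 * (- e)) *\<^sub>R S (T f \<circ>\<^sub>J T x) + ?c *\<^sub>R 1 \<in> positive_cone"
    using f xs by (subst (asm) T_positive_iff) (auto simp: T_in)
  have Bx: "2 *\<^sub>R B f x = - B f b"
  proof -
    have "2 *\<^sub>R B f x = B f (2 *\<^sub>R x)" using f xs by (simp add: B_scaleR)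
    also have "2 *\<^sub>R x = 1 + (-1) *\<^sub>R b" by (simp add: x_def)
    also have "B f (1 + (-1) *\<^sub>R b) = B f 1 + B f ((-1) *\<^sub>R b)"
      by (rule B_add) (use f b in auto)
    also have "B f ((-1) *\<^sub>R b) = (-1) *\<^sub>R B f b"
      by (rule B_scaleR[OF f b(1)])
    finally show ?thesis using f by (simp add: B_one)
  qed
  have "(x + (2 * e) *\<^sub>R (f \<circ>\<^sub>J x) + ?c *\<^sub>R 1) + (x + (2 * (- e)) *\<^sub>R S (T f \<circ>\<^sub>J T x) + ?c *\<^sub>R 1)
      = 2 *\<^sub>R x + e *\<^sub>R (2 *\<^sub>R B f x) + (2 * ?c) *\<^sub>R 1"
  proof -
    have "(x + (2 * e) *\<^sub>R u + p) + (x + (2 * (- e)) *\<^sub>R v + p) = (x + x) + (2 * e) *\<^sub>R (u - v) + (p + p)"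
      for u v p :: 'm
      by (simp add: scaleR_diff_right)
    moreover have "(2 * e) *\<^sub>R B f x = e *\<^sub>R (2 *\<^sub>R B f x)" by simp
    moreover have "(2 * ?c) *\<^sub>R (1::'m) = ?c *\<^sub>R 1 + ?c *\<^sub>R 1"
      by (simp only: mult_2 scaleR_add_left)
    ultimately show ?thesis by (simp only: scaleR_2 flip: B_def)
  qed
  also have "\<dots> = (1 + 2 * e ^ 2 * norm f ^ 2) *\<^sub>R 1 - (b + e *\<^sub>R B f b)"
    unfolding Bx by (simp add: x_def algebra_simps)
  finally show ?thesis using positive_cone_add[OF 1 2] by simp
qed

lemma B_isometric_unit:
  assumes f: "f \<in> self_adjoint" and b: "b \<in> self_adjoint" "norm b \<le> 1"
  shows "norm (b + e *\<^sub>R B f b) \<le> 1 + 2 * e ^ 2 * norm f ^ 2"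
proof (rule norm_leI)
  have "B f (- b) = - B f b" using B_scaleR[OF f b(1), of "-1"] by simp
  then show "(1 + 2 * e ^ 2 * norm f ^ 2) *\<^sub>R 1 + (b + e *\<^sub>R B f b) \<in> positive_cone"
    using B_positive[OF f, of "- b" e] b by (simp add: algebra_simps)
qed (use B_positive[OF f b] in auto)

lemma B_isometric:
  assumes f: "f \<in> self_adjoint" and b: "b \<in> self_adjoint"
  shows "norm (b + e *\<^sub>R B f b) \<le> (1 + 2 * e ^ 2 * norm f ^ 2) * norm b"
proof (cases "b = 0")
  case True
  then show ?thesis using B_scaleR[OF f b, of 0] by simp
next
  case False
  define c where "c = (1 / norm b) *\<^sub>R b"
  have c: "c \<in> self_adjoint" "norm c \<le> 1" using b False by (simp_all add: c_def)
  have "b = norm b *\<^sub>R c" using False by (simp add: c_def)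
  then have "b + e *\<^sub>R B f b = norm b *\<^sub>R (c + e *\<^sub>R B f c)"
    using B_scaleR[OF f c(1), of "norm b"] by (simp add: scaleR_add_right mult.commute)
  then have "norm (b + e *\<^sub>R B f b) = norm b * norm (c + e *\<^sub>R B f c)"
    by simp
  also have "\<dots> \<le> norm b * (1 + 2 * e ^ 2 * norm f ^ 2)"
    by (intro mult_left_mono B_isometric_unit[OF f c]) auto
  finally show ?thesis by (simp add: mult.commute)
qed

lemma T_jprod:
  assumes a: "a \<in> self_adjoint" and b: "b \<in> self_adjoint"
  shows "T (a \<circ>\<^sub>J b) = T a \<circ>\<^sub>J T b"
proof -
  \<comment> \<open>The constant 2 serves twice: \<open>B\<close> is a difference of two contractive
    products, and \<open>B_isometric\<close> has the coefficient 2 at second order.\<close>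
  interpret infinitesimal_isometries self_adjoint B 2
  proof
    show "subspace (self_adjoint :: 'm set)" by (rule subspace_self_adjoint)
    show "norm (B a b) \<le> 2 * norm a * norm b" if "a \<in> self_adjoint" "b \<in> self_adjoint" for a b
    proof -
      have "norm (B a b) = norm (T (a \<circ>\<^sub>J b) - T a \<circ>\<^sub>J T b)"
        using that by (simp flip: T_B norm_T add: B_in)
      also have "\<dots> \<le> norm (a \<circ>\<^sub>J b) + norm (T a \<circ>\<^sub>J T b)"
        using that norm_triangle_ineq4[of "T (a \<circ>\<^sub>J b)" "T a \<circ>\<^sub>J T b"] by simp
      also have "\<dots> \<le> 2 * norm a * norm b"
        using that norm_jprod_le[of a b] norm_jprod_le[of "T a" "T b"] by simp
      finally show ?thesis .
    qed
    show "B a b = B b a" for a b by (simp add: B_def jprod_commute)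
  qed (use B_in B_add B_isometric in auto)
  have "B a b = 0" by (rule B_eq_zero[OF a b])
  then show ?thesis using T_B[OF a b] by simp
qed

section \<open>Complexification of the real isomorphism\<close>

definition "J z = T ((1/2) *\<^sub>R (z + star z)) + \<i> *\<^sub>C T ((1/2) *\<^sub>R ((- \<i>) *\<^sub>C (z - star z)))"

lemma J_eq:
  assumes "a \<in> self_adjoint" "b \<in> self_adjoint"
  shows "J (a + \<i> *\<^sub>C b) = T a + \<i> *\<^sub>C T b"
proof -
  have st: "star (a + \<i> *\<^sub>C b) = a - \<i> *\<^sub>C b"
    using assms by (simp add: self_adjoint_def star_add star_scaleC scaleC_minus_left)
  have "(1/2) *\<^sub>R (a + \<i> *\<^sub>C b + star (a + \<i> *\<^sub>C b)) = a"
    unfolding st by (simp flip: scaleR_2)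
  moreover have "(1/2) *\<^sub>R ((- \<i>) *\<^sub>C (a + \<i> *\<^sub>C b - star (a + \<i> *\<^sub>C b))) = b"
  proof -
    have "(- \<i>) *\<^sub>C (a + \<i> *\<^sub>C b - star (a + \<i> *\<^sub>C b)) = b + b"
      unfolding st by (simp add: scaleC_minus_left scaleC_add_right)
    then show ?thesis by simp
  qed
  ultimately show ?thesis unfolding J_def by simp
qed

end

lemma self_adjoint_decomposition:
  fixes z :: "'a::jb_star_algebra"
  obtains a b where "a \<in> self_adjoint" "b \<in> self_adjoint" "z = a + \<i> *\<^sub>C b"
proof (rule that)
  show "(1/2) *\<^sub>R (z + star z) \<in> self_adjoint"
    by (simp add: self_adjoint_def star_scaleR star_add star_star add.commute)
  show "(1/2) *\<^sub>R ((- \<i>) *\<^sub>C (z - star z)) \<in> self_adjoint"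
    by (simp add: self_adjoint_def star_scaleR star_scaleC star_diff star_star
        scaleC_minus_left scaleC_diff_right)
  have "\<i> *\<^sub>C (1/2) *\<^sub>R ((- \<i>) *\<^sub>C w) = (1/2) *\<^sub>R w" for w :: 'a
    by (simp add: scaleC_scaleR scaleC_minus_left scaleC_minus_right)
  then have "(1/2) *\<^sub>R (z + star z) + \<i> *\<^sub>C (1/2) *\<^sub>R ((- \<i>) *\<^sub>C (z - star z)) = (1/2 + 1/2) *\<^sub>R z"
    unfolding scaleR_add_left by (simp only: scaleR_add_right scaleR_diff_right) simp
  then show "z = (1/2) *\<^sub>R (z + star z) + \<i> *\<^sub>C (1/2) *\<^sub>R ((- \<i>) *\<^sub>C (z - star z))"
    by simp
qed

context cone_isometry
begin

lemma jordan_star_isomorphism_J: "jordan_star_isomorphism J"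
  unfolding jordan_star_isomorphism_def
proof (intro conjI allI)
  show add: "J (x + y) = J x + J y" for x y
  proof -
    obtain a b where x: "a \<in> self_adjoint" "b \<in> self_adjoint" "x = a + \<i> *\<^sub>C b"
      by (rule self_adjoint_decomposition)
    obtain c d where y: "c \<in> self_adjoint" "d \<in> self_adjoint" "y = c + \<i> *\<^sub>C d"
      by (rule self_adjoint_decomposition)
    have xy: "x + y = (a + c) + \<i> *\<^sub>C (b + d)"
      using x y by (simp add: scaleC_add_right)
    have "J (x + y) = T (a + c) + \<i> *\<^sub>C T (b + d)"
      unfolding xy using x y by (intro J_eq) simp_all
    then show ?thesis
      using x y by (simp add: J_eq T_add scaleC_add_right)
  qed
  show "J (z *\<^sub>C x) = z *\<^sub>C J x" for z x
  proof -
    obtain a b where x: "a \<in> self_adjoint" "b \<in> self_adjoint" "x = a + \<i> *\<^sub>C b"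
      by (rule self_adjoint_decomposition)
    let ?r = "Re z" and ?s = "Im z"
    have "z *\<^sub>C x = (?r *\<^sub>R a - ?s *\<^sub>R b) + \<i> *\<^sub>C (?r *\<^sub>R b + ?s *\<^sub>R a)"
      unfolding x by (subst scaleC_complex)
        (simp add: scaleC_add_right scaleC_scaleR scaleR_add_right scaleR_diff_right)
    then have "J (z *\<^sub>C x) = T (?r *\<^sub>R a - ?s *\<^sub>R b) + \<i> *\<^sub>C T (?r *\<^sub>R b + ?s *\<^sub>R a)"
      using J_eq[of "?r *\<^sub>R a - ?s *\<^sub>R b" "?r *\<^sub>R b + ?s *\<^sub>R a"] x by simp
    also have "\<dots> = z *\<^sub>C (T a + \<i> *\<^sub>C T b)"
      using x by (subst (2) scaleC_complex)
        (simp add: T_add T_diff T_scaleR scaleC_add_right scaleC_scaleR scaleR_add_right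
          scaleR_diff_right)
    finally show ?thesis using x by (simp add: J_eq)
  qed
  show "J (x \<circ>\<^sub>J y) = J x \<circ>\<^sub>J J y" for x y
  proof -
    obtain a b where x: "a \<in> self_adjoint" "b \<in> self_adjoint" "x = a + \<i> *\<^sub>C b"
      by (rule self_adjoint_decomposition)
    obtain c d where y: "c \<in> self_adjoint" "d \<in> self_adjoint" "y = c + \<i> *\<^sub>C d"
      by (rule self_adjoint_decomposition)
    have "x \<circ>\<^sub>J y = (a \<circ>\<^sub>J c - b \<circ>\<^sub>J d) + \<i> *\<^sub>C (a \<circ>\<^sub>J d + b \<circ>\<^sub>J c)"
      using x y by (simp add: jprod_simps scaleC_add_right)
    then have "J (x \<circ>\<^sub>J y) = T (a \<circ>\<^sub>J c - b \<circ>\<^sub>J d) + \<i> *\<^sub>C T (a \<circ>\<^sub>J d + b \<circ>\<^sub>J c)"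
      using J_eq[of "a \<circ>\<^sub>J c - b \<circ>\<^sub>J d" "a \<circ>\<^sub>J d + b \<circ>\<^sub>J c"] x y by simp
    then show ?thesis
      using x y by (simp add: J_eq T_add T_diff T_jprod jprod_simps scaleC_add_right)
  qed
  show "J (star x) = star (J x)" for x
  proof -
    obtain a b where x: "a \<in> self_adjoint" "b \<in> self_adjoint" "x = a + \<i> *\<^sub>C b"
      by (rule self_adjoint_decomposition)
    have "star x = a + \<i> *\<^sub>C (- b)"
      using x by (simp add: self_adjoint_def star_add star_scaleC scaleC_minus_left scaleC_minus_right)
    then have "J (star x) = T a + \<i> *\<^sub>C T (- b)"
      using J_eq[of a "- b"] x by simp
    moreover have "star (T a) = T a" "star (T b) = T b"
      using T_in x by (auto simp: self_adjoint_def)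
    ultimately show ?thesis
      using x by (simp add: J_eq T_minus star_add star_scaleC scaleC_minus_left scaleC_minus_right)
  qed
  have "x = y" if "J x = J y" for x y
  proof -
    obtain a b where x: "a \<in> self_adjoint" "b \<in> self_adjoint" "x - y = a + \<i> *\<^sub>C b"
      by (rule self_adjoint_decomposition)
    have "J (x - y) + J y = J x" by (simp flip: add)
    then have z: "T a + \<i> *\<^sub>C T b = 0" using that x by (simp add: J_eq)
    have s: "star (T a) = T a" "star (T b) = T b"
      using T_in x by (auto simp: self_adjoint_def)
    \<comment> \<open>Applying the involution flips the sign of the imaginary part, so both parts
      vanish.\<close>
    have "star (T a + \<i> *\<^sub>C T b) = 0" unfolding z by simp
    then have "T a - \<i> *\<^sub>C T b = 0" by (simp add: star_add star_scaleC s scaleC_minus_left)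
    then have "2 *\<^sub>R T a = 0" using z by (simp add: scaleR_2 add_eq_0_iff)
    then have Ta: "T a = 0" by simp
    then have "\<i> *\<^sub>C \<i> *\<^sub>C T b = 0" using z by simp
    then have "T b = 0" by simp
    then have "a = 0" "b = 0" using Ta norm_T x by (metis norm_eq_zero)+
    then show "x = y" using x by simp
  qed
  moreover have "\<exists>x. J x = y" for y
  proof -
    obtain c d where y: "c \<in> self_adjoint" "d \<in> self_adjoint" "y = c + \<i> *\<^sub>C d"
      by (rule self_adjoint_decomposition)
    then show ?thesis using ex_T_preimage[of c] ex_T_preimage[of d] J_eq by metis
  qed
  ultimately show "bij J" by (metis bijI')
qed

end

theorem proposition4p9:
  fixes \<Delta> :: "'m::unital_jb_star_algebra \<Rightarrow> 'n::unital_jb_star_algebra"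
  assumes surj: "\<Delta> ` positive_invertibles = positive_invertibles"
    and isometry: "\<And>a b. a \<in> positive_invertibles \<Longrightarrow> b \<in> positive_invertibles \<Longrightarrow>
                     dist (\<Delta> a) (\<Delta> b) = dist a b"
  shows "\<exists>J :: 'm \<Rightarrow> 'n. jordan_star_isomorphism J \<and> (\<forall>a\<in>positive_invertibles. J a = \<Delta> a)"
proof -
  interpret cone_isometry \<Delta>
    by unfold_locales (use surj isometry in auto)
  have "J a = \<Delta> a" if "a \<in> positive_invertibles" for a
    using J_eq[OF positive_invertibles_self_adjoint[OF that] self_adjoint_zero] T_eq_image[OF that]
    by simp
  then show ?thesis using jordan_star_isomorphism_J by blast
qed

end
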